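(* Let $n\ge 2$ be fixed. For each $K\ge 0$ let $D_n^K$ be the boundary curve of the random $n$-core obtained after $K$ time steps of the random $n$-core growth process, scaled so that the area of the $n$-core is $1$. Let $C_n$ be the piecewise linear curve with vertices $$v_i=\gamma\left(\binom{i}{2},\binom{n-i+1}{2}\right),\quad i=1,\dots,n,\qquad \gamma=\frac{2\sqrt 6}{n\sqrt{n^2-1}}.$$ Then for all $\epsilon,\delta>0$ there is an $L$ such that for all $K>L$, $$\mathbb P\left(|D_n^K-C_n|>\delta\right)<\epsilon ,$$ where $|D_n^K-C_n|$ is the supremum, over all diagonals (lines of constant content), of the distance between the two curves measured along the diagonal.
   Context: A partition is drawn as a Young diagram of left-justified unit boxes, rows listed from top to bottom; box $(i,j)$ is in row $i$ and column $j$. The hook of a cell is the cell itself together with the cells directly to its right and directly below it, and the hook length is the number of cells in the hook. An $n$-core is a partition having no cell with hook length divisible by $n$. Growth process: start from the empty diagram. Each position $(i,j)$, $i,j\ge1$, of the quarter plane has content $j-i \pmod n$. A growth corner of a Young diagram is a position just outside the diagram where a box can be added so that the result is still a Young diagram. At each time step an integer $t\in\{0,1,\dots,n-1\}$ is chosen uniformly at random (independently of the past), and a box is added at every growth corner with content $t \pmod n$ (if there are none, nothing changes). All diagrams obtained are $n$-cores. Coordinates: the corner of the diagram is at the origin, the $x$-axis points right along the rows and the $y$-axis points down along the columns, so diagrams lie in the quadrant $x,y\ge0$. The diagonals of constant content are the lines $y=x+c$, $c\in\mathbb R$. Each curve (the boundary $D_n^K$ separating the scaled diagram from its complement, and $C_n$)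 is regarded as continued along the coordinate axes beyond its end points, so that it meets each diagonal in exactly one point. The constant $\gamma$ makes the area between $C_n$ and the axes equal to $1$. (If the diagram is empty, $D_n^K$ is undefined and this is counted in the event $|D_n^K-C_n|>\delta$.) *)

theory Defs
  imports "HOL-Probability.Probability"
begin

text \<open>A partition is represented by its set of boxes \<open>(i, j)\<close>: row \<open>i \<ge> 1\<close> counted from the top,
  column \<open>j \<ge> 1\<close> counted from the left.\<close>

definition young_diagram :: "(nat \<times> nat) set \<Rightarrow> bool" where
  "young_diagram D \<longleftrightarrow> finite D \<and> (\<forall>(i, j)\<in>D. 1 \<le> i \<and> 1 \<le> j) \<and>
     (\<forall>(i, j)\<in>D. \<forall>i' j'. 1 \<le> i' \<and> i' \<le> i \<and> 1 \<le> j' \<and> j' \<le> j \<longrightarrow> (i', j') \<in> D)"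

definition growth_corner :: "(nat \<times> nat) set \<Rightarrow> nat \<times> nat \<Rightarrow> bool" where
  "growth_corner D b \<longleftrightarrow> b \<notin> D \<and> young_diagram (insert b D)"

definition box_content :: "nat \<times> nat \<Rightarrow> int" where
  "box_content b = int (snd b) - int (fst b)"

definition growth_step :: "nat \<Rightarrow> nat \<Rightarrow> (nat \<times> nat) set \<Rightarrow> (nat \<times> nat) set" where
  "growth_step n t D = D \<union> {b. growth_corner D b \<and> box_content b mod int n = int t}"

primrec random_core :: "nat \<Rightarrow> nat \<Rightarrow> (nat \<times> nat) set pmf" where
  "random_core n 0 = return_pmf {}"
| "random_core n (Suc K) =
     bind_pmf (random_core n K) (\<lambda>D. map_pmf (\<lambda>t. growth_step n t D) (pmf_of_set {0..<n}))"

text \<open>Points of the plane are pairs \<open>(x, y)\<close> with the \<open>y\<close>-axis pointing down, so the box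
  in row \<open>i\<close> and column \<open>j\<close> is the unit square \<open>[j - 1, j] \<times> [i - 1, i]\<close>.\<close>

definition quadrant :: "(real \<times> real) set" where
  "quadrant = {(x, y). 0 \<le> x \<and> 0 \<le> y}"

definition region :: "(nat \<times> nat) set \<Rightarrow> (real \<times> real) set" where
  "region D = (\<Union>(i, j)\<in>D. {real j - 1..real j} \<times> {real i - 1..real i})"

definition scaled_region :: "(nat \<times> nat) set \<Rightarrow> (real \<times> real) set" where
  "scaled_region D = (\<lambda>p. p /\<^sub>R sqrt (measure lborel (region D))) ` region D"

text \<open>The boundary is taken relative to the quadrant: the parts of the coordinate axes that lie
  along the diagram do not belong to it.\<close>

definition boundary_curve :: "(nat \<times> nat) set \<Rightarrow> (real \<times> real) set" where
  "boundary_curve D = scaled_region D \<inter> closure (quadrant - scaled_region D)"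

definition gamma_const :: "nat \<Rightarrow> real" where
  "gamma_const n = 2 * sqrt 6 / (real n * sqrt ((real n)\<^sup>2 - 1))"

definition vertex :: "nat \<Rightarrow> nat \<Rightarrow> real \<times> real" where
  "vertex n i = gamma_const n *\<^sub>R (real (i choose 2), real ((n - i + 1) choose 2))"

definition limit_curve :: "nat \<Rightarrow> (real \<times> real) set" where
  "limit_curve n = (\<Union>i\<in>{1..<n}. closed_segment (vertex n i) (vertex n (Suc i)))"

text \<open>Continuation of a curve along the coordinate axes, outwards from its end points on them.\<close>

definition continued :: "(real \<times> real) set \<Rightarrow> (real \<times> real) set" where
  "continued A = A \<union> {(x, 0) | x. \<exists>a\<le>x. (a, 0) \<in> A} \<union> {(0, y) | y. \<exists>b\<le>y. (0, b) \<in> A}"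

definition diagonal :: "real \<Rightarrow> (real \<times> real) set" where
  "diagonal c = {(x, y). y = x + c}"

text \<open>Meaningful for curves that, after continuation, meet each diagonal in exactly one point and
  that are bounded before it, so that the supremum is over a bounded set. The boundary curve of a
  nonempty Young diagram and the limit curve for \<open>n \<ge> 2\<close> are such curves.\<close>

definition curve_dist :: "(real \<times> real) set \<Rightarrow> (real \<times> real) set \<Rightarrow> real" where
  "curve_dist A B =
     (SUP c. dist (THE p. p \<in> continued A \<inter> diagonal c) (THE p. p \<in> continued B \<inter> diagonal c))"

end

theory Submission
  imports Defs
begin

text \<open>
  Record a diagram by its height function: \<open>(i, j)\<close> is a box iff \<open>i + j \<le> \<phi> (j - i)\<close>. Growing at
  content \<open>t\<close> replaces \<open>\<phi> c\<close> by \<open>min (\<phi> (c - 1)) (\<phi> (c + 1)) + 1\<close> for all \<open>c\<close> congruent to \<open>t\<close>, which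
  does not increase the supremum distance between height functions. On the abacus with \<open>n\<close> runners
  the core is given by the levels \<open>a\<^sub>0 < \<dots> < a\<^sub>n\<^sub>-\<^sub>1\<close> of the runners, whose residues perform a
  multi-species exclusion process on the ring. The residues of the \<open>m\<close> largest levels form a
  one-species exclusion process, for which the uniform distribution is stationary; the sum of these
  levels grows by the number of jumps. Hence it has mean \<open>K m (n - m) / (n (n - 1))\<close> after \<open>K\<close> steps,
  up to a bounded error, since by nonexpansiveness the number of jumps depends on the initial
  configuration only up to a constant. The same fact bounds the effect of each single choice, so the
  variance is \<open>O(K)\<close>. Differences over \<open>m\<close> show that \<open>a\<^sub>i / K\<close> tends to
  \<open>(2 i + 1 - n) / (n (n - 1))\<close> in probability. The height function is within a constant of
  \<open>c \<mapsto> (\<Sum>i. |a\<^sub>i - c|) / n\<close>, the number of boxes is \<open>(\<Sum>i. a\<^sub>i\<^sup>2 - i\<^sup>2) / (2 n)\<close>, and the limit curve is the graph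
  of the corresponding sum for the limits of the rescaled \<open>a\<^sub>i\<close>.
\<close>

section \<open>Boundary curves of staircase regions\<close>

text \<open>The labelled process of all levels is awkward to treat directly: already for n = 3 its
  stationary law is not uniform, because the two cyclic orders of the species admit one and two
  exchanges. Forgetting everything except which residues belong to the m largest levels restores
  uniformity. No mixing estimate enters. Since \<open>min\<close> is 1-Lipschitz, two runs with the
  same choices and equally many particles keep a bounded height difference forever; an exact
  identity for the average over all starting configurations then gives the mean from every single
  start, and the same comparison bounds how far the conditional mean moves with the first choice.
  After that everything is deterministic: the area is a quadratic function of the levels, so one law
  of large numbers controls both the shape and the scaling factor, and both curves are graphs of x +
  y over x - y. The content is x - y, whereas \<open>diagonal c\<close> fixes y - x, hence the sign
  change in the final comparison.\<close>

lemma continued_iff: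
  "(x, y) \<in> continued A \<longleftrightarrow> (x, y) \<in> A \<or> y = 0 \<and> (\<exists>a\<le>x. (a, 0) \<in> A) \<or> x = 0 \<and> (\<exists>b\<le>y. (0, b) \<in> A)"
  by (auto simp: continued_def)

text \<open>Compactness and closure under moving towards the axes are all that the geometry of a
  boundary curve requires, so scaled diagrams enter only through these assumptions.\<close>

locale staircase_region =
  fixes R :: "(real \<times> real) set"
  assumes compact_R: "compact R" and R_nonempty: "R \<noteq> {}" and R_quadrant: "R \<subseteq> quadrant"
    and R_downward: "\<And>x y x' y'. (x, y) \<in> R \<Longrightarrow> 0 \<le> x' \<Longrightarrow> x' \<le> x \<Longrightarrow> 0 \<le> y' \<Longrightarrow> y' \<le> y \<Longrightarrow> (x', y') \<in> R"
begin

lemma R_nonneg: "(x, y) \<in> R \<Longrightarrow> 0 \<le> x \<and> 0 \<le> y"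
  using R_quadrant by (auto simp: quadrant_def)

text \<open>Pushing along the diagonal decides membership: if (x + e, y + e) is in \<open>R\<close>,
  every point of the quadrant strictly above and to the left of it is in \<open>R\<close>, which
  gives a neighbourhood of (x, y); otherwise the pushed points lie outside \<open>R\<close> and tend
  to (x, y).\<close>

lemma boundary_iff:
  "(x, y) \<in> R \<inter> closure (quadrant - R) \<longleftrightarrow> (x, y) \<in> R \<and> (\<forall>e>0. (x + e, y + e) \<notin> R)"
proof safe
  fix e :: real
  assume p: "(x, y) \<in> R" "(x, y) \<in> closure (quadrant - R)" and e: "0 < e" and out: "(x + e, y + e) \<in> R"
  have "({..<x + e} \<times> {..<y + e}) \<inter> (quadrant - R) = {}"
    using R_downward[OF out] by (force simp: quadrant_def)
  moreover have "open ({..<x + e} \<times> {..<y + e})" by (intro open_Times) auto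
  ultimately have "({..<x + e} \<times> {..<y + e}) \<inter> closure (quadrant - R) = {}"
    using open_Int_closure_eq_empty by blast
  moreover have "(x, y) \<in> {..<x + e} \<times> {..<y + e}" using e by simp
  ultimately show False using p by blast
next
  assume p: "(x, y) \<in> R" and out: "\<forall>e>0. (x + e, y + e) \<notin> R"
  have lim: "((\<lambda>e. (x + e, y + e)) \<longlongrightarrow> (x + 0, y + 0)) (at_right 0)"
    by (intro tendsto_intros)
  have ev: "\<forall>\<^sub>F e in at_right 0. (x + e, y + e) \<in> closure (quadrant - R)"
    unfolding eventually_at_filter
  proof (intro always_eventually allI impI)
    fix e :: real assume "e \<in> {0<..}"
    then have "(x + e, y + e) \<in> quadrant - R" using out R_nonneg[OF p] by (auto simp: quadrant_def)
    then show "(x + e, y + e) \<in> closure (quadrant - R)" by (rule subsetD[OF closure_subset])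
  qed
  show "(x, y) \<in> closure (quadrant - R)"
    using Lim_in_closed_set[OF closed_closure ev trivial_limit_at_right_real lim] by simp
qed

text \<open>The continuation along an axis keeps the property that no diagonal push leads into
  \<open>R\<close>: moving a pushed point back towards the end point would give a push of the end
  point itself.\<close>

lemma continued_boundaryD:
  assumes "(x, y) \<in> continued (R \<inter> closure (quadrant - R))"
  shows "(x, y) \<in> R \<or> 0 \<le> x \<and> y = 0 \<or> x = 0 \<and> 0 \<le> y"
    and "\<forall>e>0. (x + e, y + e) \<notin> R"
proof -
  consider (mem) "(x, y) \<in> R \<inter> closure (quadrant - R)"
    | (hor) a where "y = 0" "a \<le> x" "(a, 0) \<in> R \<inter> closure (quadrant - R)"
    | (ver) b where "x = 0" "b \<le> y" "(0, b) \<in> R \<inter> closure (quadrant - R)"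
    using assms unfolding continued_iff by blast
  then have "((x, y) \<in> R \<or> 0 \<le> x \<and> y = 0 \<or> x = 0 \<and> 0 \<le> y) \<and> (\<forall>e>0. (x + e, y + e) \<notin> R)"
  proof cases
    case mem
    then show ?thesis using boundary_iff by blast
  next
    case hor
    have a: "(a, 0) \<in> R" "\<forall>e>0. (a + e, 0 + e) \<notin> R" using hor(3) unfolding boundary_iff by auto
    have a0: "0 \<le> a" using R_nonneg[OF a(1)] by simp
    have "(x + e, y + e) \<notin> R" if e: "0 < e" for e
      using a(2) e R_downward[of "x + e" "y + e" "a + e" "0 + e"] hor(1,2) a0 by auto
    then show ?thesis using hor a0 by auto
  next
    case ver
    have b: "(0, b) \<in> R" "\<forall>e>0. (0 + e, b + e) \<notin> R" using ver(3) unfolding boundary_iff by auto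
    have b0: "0 \<le> b" using R_nonneg[OF b(1)] by simp
    have "(x + e, y + e) \<notin> R" if e: "0 < e" for e
      using b(2) e R_downward[of "x + e" "y + e" "0 + e" "b + e"] ver(1,2) b0 by auto
    then show ?thesis using ver b0 by auto
  qed
  then show "(x, y) \<in> R \<or> 0 \<le> x \<and> y = 0 \<or> x = 0 \<and> 0 \<le> y" "\<forall>e>0. (x + e, y + e) \<notin> R" by auto
qed

lemma closed_line: "closed {p :: real \<times> real. a * fst p + b * snd p = c}"
  by (intro closed_Collect_eq continuous_intros)

lemma maximal_point:
  fixes f :: "real \<times> real \<Rightarrow> real"
  assumes "(x0, y0) \<in> R" "a * x0 + b * y0 = c" "continuous_on UNIV f"
  obtains x y where "(x, y) \<in> R" "a * x + b * y = c"
    "\<And>x' y'. (x', y') \<in> R \<Longrightarrow> a * x' + b * y' = c \<Longrightarrow> f (x', y') \<le> f (x, y)"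
proof -
  let ?S = "R \<inter> {p. a * fst p + b * snd p = c}"
  have "compact ?S" using compact_R closed_line by (rule compact_Int_closed)
  moreover have "(x0, y0) \<in> ?S" using assms by simp
  then have "?S \<noteq> {}" by blast
  moreover have "continuous_on ?S f" using assms(3) continuous_on_subset by blast
  ultimately obtain p where "p \<in> ?S" "\<forall>q\<in>?S. f q \<le> f p" using continuous_attains_sup by blast
  then show ?thesis using that[of "fst p" "snd p"] by auto
qed

lemma zero_in_R: "(0, 0) \<in> R"
proof -
  obtain x y where "(x, y) \<in> R" using R_nonempty by (metis equals0I surj_pair)
  then show ?thesis using R_downward[of x y 0 0] R_nonneg by auto
qed

text \<open>On a diagonal that meets \<open>R\<close>, compactness yields a last point, which is a
  boundary point. Otherwise the last point of \<open>R\<close> on the appropriate axis is a boundary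
  point, and the continuation from there reaches the diagonal.\<close>

lemma continued_boundary_meets_diagonal:
  "\<exists>p. p \<in> continued (R \<inter> closure (quadrant - R)) \<inter> diagonal c"
proof -
  have cont: "continuous_on UNIV (fst :: real \<times> real \<Rightarrow> real)" "continuous_on UNIV (snd :: real \<times> real \<Rightarrow> real)"
    by (intro continuous_intros)+
  show ?thesis
  proof (cases "\<exists>x y. (x, y) \<in> R \<and> y = x + c")
    case True
    then obtain x0 y0 where "(x0, y0) \<in> R" "- 1 * x0 + 1 * y0 = c" by auto
    note max = maximal_point[OF this cont(1)]
    obtain x y where xy: "(x, y) \<in> R" "- 1 * x + 1 * y = c"
      "\<And>x' y'. (x', y') \<in> R \<Longrightarrow> - 1 * x' + 1 * y' = c \<Longrightarrow> fst (x', y') \<le> fst (x, y)"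
      by (rule max) (rule that)
    have "(x + e, y + e) \<notin> R" if "0 < e" for e using xy(3)[of "x + e" "y + e"] xy(2) that by auto
    then have "(x, y) \<in> R \<inter> closure (quadrant - R)" using xy(1) boundary_iff by blast
    then have "(x, y) \<in> continued (R \<inter> closure (quadrant - R)) \<inter> diagonal c"
      using xy(2) by (auto simp: continued_def diagonal_def)
    then show ?thesis ..
  next
    case False
    show ?thesis
    proof (cases "c \<le> 0")
      case True
      obtain a b where ab: "(a, b) \<in> R" "0 * a + 1 * b = 0"
        "\<And>x' y'. (x', y') \<in> R \<Longrightarrow> 0 * x' + 1 * y' = 0 \<Longrightarrow> fst (x', y') \<le> fst (a, b)"
        by (rule maximal_point[OF zero_in_R _ cont(1), of 0 1 0]) (simp, rule that)
      then have b: "b = 0" by simp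
      have "a \<le> - c"
      proof (rule ccontr)
        assume "\<not> a \<le> - c"
        then have "(- c, - c + c) \<in> R" using R_downward[OF ab(1), of "- c" 0] True b by simp
        then show False using False by blast
      qed
      moreover have "(a, 0) \<in> R \<inter> closure (quadrant - R)"
        unfolding boundary_iff
      proof (intro conjI allI impI)
        fix e :: real assume e: "0 < e"
        have a0: "0 \<le> a" using R_nonneg[OF ab(1)] by simp
        show "(a + e, 0 + e) \<notin> R"
        proof
          assume "(a + e, 0 + e) \<in> R"
          then have "(a + e, 0) \<in> R" by (rule R_downward) (use e a0 in auto)
          then show False using ab(3)[of "a + e" 0] e by simp
        qed
      qed (use ab b in auto)
      ultimately have "(- c, 0) \<in> continued (R \<inter> closure (quadrant - R))"
        unfolding continued_iff by blast
      moreover have "(- c, 0) \<in> diagonal c" by (simp add: diagonal_def)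
      ultimately show ?thesis by blast
    next
      case c: False
      obtain a b where ab: "(a, b) \<in> R" "1 * a + 0 * b = 0"
        "\<And>x' y'. (x', y') \<in> R \<Longrightarrow> 1 * x' + 0 * y' = 0 \<Longrightarrow> snd (x', y') \<le> snd (a, b)"
        by (rule maximal_point[OF zero_in_R _ cont(2), of 1 0 0]) (simp, rule that)
      then have a: "a = 0" by simp
      have "b \<le> c"
      proof (rule ccontr)
        assume "\<not> b \<le> c"
        then have "(0, 0 + c) \<in> R" using R_downward[OF ab(1), of 0 c] c a by simp
        then show False using False by blast
      qed
      moreover have "(0, b) \<in> R \<inter> closure (quadrant - R)"
        unfolding boundary_iff
      proof (intro conjI allI impI)
        fix e :: real assume e: "0 < e"
        have b0: "0 \<le> b" using R_nonneg[OF ab(1)] by simp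
        show "(0 + e, b + e) \<notin> R"
        proof
          assume "(0 + e, b + e) \<in> R"
          then have "(0, b + e) \<in> R" by (rule R_downward) (use e b0 in auto)
          then show False using ab(3)[of 0 "b + e"] e by simp
        qed
      qed (use ab a in auto)
      ultimately have "(0, c) \<in> continued (R \<inter> closure (quadrant - R))"
        unfolding continued_iff by blast
      moreover have "(0, c) \<in> diagonal c" by (simp add: diagonal_def)
      ultimately show ?thesis by blast
    qed
  qed
qed

text \<open>The farther of two points on a diagonal cannot be in \<open>R\<close>, so it lies on an
  axis; going back from an axis along the diagonal leaves the quadrant.\<close>

lemma continued_boundary_diagonal_less:
  assumes "(x, x + c) \<in> continued (R \<inter> closure (quadrant - R))"
    "(x', x' + c) \<in> continued (R \<inter> closure (quadrant - R))"
  shows "\<not> x < x'"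
proof
  assume less: "x < x'"
  have "(x', x' + c) \<notin> R" using continued_boundaryD(2)[OF assms(1)] less
    by (auto dest: spec[of _ "x' - x"] simp: algebra_simps)
  then have "x' = 0 \<or> x' + c = 0" using continued_boundaryD(1)[OF assms(2)] by auto
  then show False using continued_boundaryD(1)[OF assms(1)] R_nonneg less by force
qed

lemma ex1_continued_boundary: "\<exists>!p. p \<in> continued (R \<inter> closure (quadrant - R)) \<inter> diagonal c"
proof (rule ex_ex1I[OF continued_boundary_meets_diagonal])
  fix p q
  assume "p \<in> continued (R \<inter> closure (quadrant - R)) \<inter> diagonal c"
    "q \<in> continued (R \<inter> closure (quadrant - R)) \<inter> diagonal c"
  then obtain x x' where "p = (x, x + c)" "q = (x', x' + c)"
    "(x, x + c) \<in> continued (R \<inter> closure (quadrant - R))"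
    "(x', x' + c) \<in> continued (R \<inter> closure (quadrant - R))"
    by (auto simp: diagonal_def)
  then show "p = q"
    using continued_boundary_diagonal_less[of x c x'] continued_boundary_diagonal_less[of x' c x] by auto
qed

end

section \<open>Scaled Young diagrams as staircase regions, and their area\<close>

lemma mem_region_iff:
  "(x, y) \<in> region D \<longleftrightarrow> (\<exists>i j. (i, j) \<in> D \<and> real j - 1 \<le> x \<and> x \<le> real j \<and> real i - 1 \<le> y \<and> y \<le> real i)"
  unfolding region_def by (auto simp: split_beta Bex_def)

lemma young_diagramD:
  assumes "young_diagram D" "(i, j) \<in> D"
  shows "1 \<le> i" "1 \<le> j" "\<And>i' j'. 1 \<le> i' \<Longrightarrow> i' \<le> i \<Longrightarrow> 1 \<le> j' \<Longrightarrow> j' \<le> j \<Longrightarrow> (i', j') \<in> D"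
  using assms unfolding young_diagram_def by auto

lemma unit_interval_containing:
  fixes x :: real
  assumes "0 \<le> x" "x \<le> real j" "1 \<le> j"
  obtains k where "1 \<le> k" "k \<le> j" "real k - 1 \<le> x" "x \<le> real k"
proof
  \<comment> \<open>The ceiling alone would give 0 at x = 0, where the first unit interval is
    wanted.\<close>
  let ?k = "max 1 (nat \<lceil>x\<rceil>)"
  show "1 \<le> ?k" by simp
  show "?k \<le> j" using assms by (simp add: nat_le_iff ceiling_le_iff)
  have "real (nat \<lceil>x\<rceil>) = of_int \<lceil>x\<rceil>" using assms by simp
  then have "real ?k = max 1 (of_int \<lceil>x\<rceil>)" by (simp only: of_nat_max of_nat_1)
  then show "real ?k - 1 \<le> x" "x \<le> real ?k"
    using assms(1) ceiling_correct[of x] by (auto simp: max_def)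
qed

lemma scaled_region_staircase:
  assumes D: "young_diagram D" "D \<noteq> {}" and s: "0 < s"
  shows "staircase_region ((\<lambda>p. p /\<^sub>R s) ` region D)"
proof
  have fin: "finite D" using D by (simp add: young_diagram_def)
  then have "compact (region D)" unfolding region_def
    by (intro compact_UN) (auto intro: compact_Times)
  then show "compact ((\<lambda>p. p /\<^sub>R s) ` region D)"
    by (intro compact_continuous_image continuous_intros)
  obtain i j where ij: "(i, j) \<in> D" using D(2) by auto
  then have "(real j, real i) \<in> region D" unfolding mem_region_iff by (intro exI[of _ i] exI[of _ j]) auto
  then show "(\<lambda>p. p /\<^sub>R s) ` region D \<noteq> {}" by blast
  have pos: "0 \<le> x \<and> 0 \<le> y" if "(x, y) \<in> region D" for x y
    using that young_diagramD(1,2)[OF D(1)] unfolding mem_region_iff by force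
  then show "(\<lambda>p. p /\<^sub>R s) ` region D \<subseteq> quadrant" using s by (auto simp: quadrant_def)
  fix x y x' y'
  assume xy: "(x, y) \<in> (\<lambda>p. p /\<^sub>R s) ` region D" and le: "0 \<le> x'" "x' \<le> x" "0 \<le> y'" "y' \<le> y"
  then obtain u v where uv: "(u, v) \<in> region D" "x = u / s" "y = v / s"
    by (auto simp: divide_inverse_commute)
  obtain i j where ij: "(i, j) \<in> D" "u \<le> real j" "v \<le> real i" using uv(1) unfolding mem_region_iff by blast
  have "x' * s \<le> real j" "y' * s \<le> real i" "0 \<le> x' * s" "0 \<le> y' * s"
    using le uv ij s by (auto simp: field_simps)
  then obtain k l where k: "1 \<le> k" "k \<le> j" "real k - 1 \<le> x' * s" "x' * s \<le> real k"
    and l: "1 \<le> l" "l \<le> i" "real l - 1 \<le> y' * s" "y' * s \<le> real l"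
    using unit_interval_containing[of "x' * s" j] unit_interval_containing[of "y' * s" i]
      young_diagramD(1,2)[OF D(1) ij(1)] by metis
  then have "(x' * s, y' * s) \<in> region D"
    using young_diagramD(3)[OF D(1) ij(1)] unfolding mem_region_iff by blast
  moreover have "(x', y') = (x' * s, y' * s) /\<^sub>R s" using s by simp
  ultimately show "(x', y') \<in> (\<lambda>p. p /\<^sub>R s) ` region D" by blast
qed

lemma measure_region:
  assumes "young_diagram D"
  shows "measure lborel (region D) = real (card D)"
proof -
  have fin: "finite D" using assms by (simp add: young_diagram_def)
  define f :: "nat \<times> nat \<Rightarrow> (real \<times> real) set"
    where "f = (\<lambda>(i, j). {real j - 1..real j} \<times> {real i - 1..real i})"
  have box: "f (i, j) = cbox (real j - 1, real i - 1) (real j, real i)" for i j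
    by (auto simp: f_def cbox_Pair_eq)
  have R: "region D = \<Union> (f ` D)" by (auto simp: region_def f_def)
  have one: "measure lebesgue (f b) = 1" for b
    by (cases b) (simp add: box content_cbox' measure_completion Basis_prod_def content_Pair)
  have "measure lebesgue (\<Union> (f ` D)) = (\<Sum>b\<in>D. measure lebesgue (f b))"
  proof (rule measure_negligible_finite_Union_image[OF fin])
    show "f b \<in> lmeasurable" for b by (cases b) (simp add: box)
    show "pairwise (\<lambda>b b'. negligible (f b \<inter> f b')) D"
    proof (rule pairwiseI)
      fix b b' :: "nat \<times> nat" assume "b \<noteq> b'"
      obtain i j i' j' where b: "b = (i, j)" "b' = (i', j')" by (metis surj_pair)
      \<comment> \<open>Two different boxes can only share points of an edge: the right edge of the
        box further left, or the lower edge of the box further up.\<close>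
      have "f b \<inter> f b' \<subseteq> {p. p \<bullet> (1, 0) = real (min j j')} \<union> {p. p \<bullet> (0, 1) = real (min i i')}"
      proof
        fix p assume p: "p \<in> f b \<inter> f b'"
        obtain x y where xy: "p = (x, y)" by (metis surj_pair)
        show "p \<in> {p. p \<bullet> (1, 0) = real (min j j')} \<union> {p. p \<bullet> (0, 1) = real (min i i')}"
        proof (cases "j = j'")
          case True
          then have "i + 1 \<le> i' \<or> i' + 1 \<le> i" using \<open>b \<noteq> b'\<close> b by auto
          then have "real i + 1 \<le> real i' \<or> real i' + 1 \<le> real i" by (metis of_nat_1 of_nat_add of_nat_le_iff)
          then have "y = real (min i i')" using p by (auto simp: f_def b xy min_def)
          then show ?thesis by (simp add: xy)
        next
          case False
          then have "j + 1 \<le> j' \<or> j' + 1 \<le> j" by auto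
          then have "real j + 1 \<le> real j' \<or> real j' + 1 \<le> real j" by (metis of_nat_1 of_nat_add of_nat_le_iff)
          then have "x = real (min j j')" using p by (auto simp: f_def b xy min_def)
          then show ?thesis by (simp add: xy)
        qed
      qed
      moreover have "negligible {p :: real \<times> real. p \<bullet> (1, 0) = real (min j j')}"
        "negligible {p :: real \<times> real. p \<bullet> (0, 1) = real (min i i')}"
        by (intro negligible_standard_hyperplane; simp add: Basis_prod_def)+
      ultimately show "negligible (f b \<inter> f b')" by (meson negligible_Un negligible_subset)
    qed
  qed
  then have "measure lebesgue (region D) = real (card D)" unfolding R by (simp add: one)
  moreover have "region D \<in> sets borel" unfolding R
    using fin by (intro sets.finite_UN) (auto simp: box)
  ultimately show ?thesis by (simp add: measure_completion)
qed

section \<open>Height functions and the abacus\<close>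

locale core_growth =
  fixes n :: nat
  assumes n_ge_2: "2 \<le> n"
begin

text \<open>On a function with steps of size 1 this turns every local minimum at a content congruent
  to t into a local maximum and changes nothing else. The form with \<open>min\<close> applies to
  all functions and makes nonexpansiveness visible.\<close>

definition raise :: "int \<Rightarrow> (int \<Rightarrow> int) \<Rightarrow> int \<Rightarrow> int" where
  "raise t \<phi> = (\<lambda>c. if c mod int n = t then min (\<phi> (c - 1)) (\<phi> (c + 1)) + 1 else \<phi> c)"

text \<open>\<open>B\<close> is a Maya diagram read along the boundary of the partition: beads are
  the descending steps of the height, gaps the ascending ones.\<close>

definition profile :: "(int \<Rightarrow> int) \<Rightarrow> int set \<Rightarrow> bool" where
  "profile \<phi> B \<longleftrightarrow> (\<forall>c. \<phi> (c + 1) = \<phi> c + (if c \<in> B then - 1 else 1))"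

text \<open>A bead moves from c - 1 to a free position c congruent to t. The two branches describe
  the right and the left member of such a pair.\<close>

definition bead_step :: "int \<Rightarrow> int set \<Rightarrow> int set" where
  "bead_step t B = {c. if c mod int n = t then c \<in> B \<or> c - 1 \<in> B
     else if (c + 1) mod int n = t then c \<in> B \<and> c + 1 \<in> B else c \<in> B}"

text \<open>The role of n >= 2: neighbouring contents are never raised in the same step, so a raised
  content has neighbours of unchanged height.\<close>

lemma mod_Suc_neq: "c mod int n = t \<Longrightarrow> (c + 1) mod int n \<noteq> t"
proof
  assume "c mod int n = t" "(c + 1) mod int n = t"
  then have "int n dvd 1"
    by (metis add_diff_cancel_left' mod_eq_dvd_iff)
  then show False using n_ge_2 by simp
qed

lemma profileD: "profile \<phi> B \<Longrightarrow> \<phi> (c + 1) = \<phi> c + (if c \<in> B then - 1 else 1)"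
  unfolding profile_def by blast

lemma profileD': "profile \<phi> B \<Longrightarrow> \<phi> (c - 1) = \<phi> c + (if c - 1 \<in> B then 1 else - 1)"
  using profileD[of \<phi> B "c - 1"] by auto

lemma raise_profile_eq:
  assumes "profile \<phi> B"
  shows "raise t \<phi> c = \<phi> c + (if c mod int n = t \<and> c - 1 \<in> B \<and> c \<notin> B then 2 else 0)"
  unfolding raise_def using profileD[OF assms, of c] profileD'[OF assms, of c] by auto

lemma profile_raise:
  assumes "profile \<phi> B"
  shows "profile (raise t \<phi>) (bead_step t B)"
  unfolding profile_def
proof
  fix c
  have 1: "c mod int n = t \<Longrightarrow> (c + 1) mod int n \<noteq> t" by (rule mod_Suc_neq)
  show "raise t \<phi> (c + 1) = raise t \<phi> c + (if c \<in> bead_step t B then - 1 else 1)"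
    unfolding raise_profile_eq[OF assms] bead_step_def
    using 1 profileD[OF assms, of c] by auto
qed

lemma raise_nonexpansive:
  assumes "\<And>c. \<bar>\<phi> c - \<psi> c\<bar> \<le> C"
  shows "\<bar>raise t \<phi> c - raise t \<psi> c\<bar> \<le> C"
  using assms[of c] assms[of "c - 1"] assms[of "c + 1"] unfolding raise_def by auto

lemma profile_unique:
  assumes "profile \<phi> B" "profile \<psi> B" "\<phi> c0 = \<psi> c0"
  shows "\<phi> = \<psi>"
proof
  fix c
  show "\<phi> c = \<psi> c"
  proof (induction c rule: int_induct[where k = c0])
    case (step1 i)
    then show ?case using profileD[OF assms(1), of i] profileD[OF assms(2), of i] by simp
  next
    case (step2 i)
    then show ?case using profileD'[OF assms(1), of i] profileD'[OF assms(2), of i] by simp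
  qed (use assms in simp)
qed

lemma profile_lipschitz:
  assumes "profile \<phi> B"
  shows "\<bar>\<phi> c - \<phi> d\<bar> \<le> \<bar>c - d\<bar>"
proof (induction c rule: int_induct[where k = d])
  case (step1 i)
  then show ?case using profileD[OF assms, of i] by (auto split: if_splits)
next
  case (step2 i)
  then show ?case using profileD'[OF assms, of i] by (auto split: if_splits)
qed simp

lemma profile_parity:
  assumes "profile \<phi> B" "even (\<phi> 0)"
  shows "even (\<phi> c + c)"
proof (induction c rule: int_induct[where k = 0])
  case (step1 i)
  then show ?case using profileD[OF assms(1), of i] by (auto split: if_splits)
next
  case (step2 i)
  then show ?case using profileD'[OF assms(1), of i] by (auto split: if_splits)
qed (use assms in simp)

text \<open>For an admissible height, \<open>\<phi> c\<close> is the value of i + j at the last box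
  of content c, or the absolute value of c if there is no such box.\<close>

definition diagram_of :: "(int \<Rightarrow> int) \<Rightarrow> (nat \<times> nat) set" where
  "diagram_of \<phi> = {(i, j). 1 \<le> i \<and> 1 \<le> j \<and> int i + int j \<le> \<phi> (int j - int i)}"

text \<open>The parity at 0 propagates to every content and, with the lower bound, makes the height
  that of a diagram; equality far out makes the diagram finite.\<close>

definition admissible :: "(int \<Rightarrow> int) \<Rightarrow> int set \<Rightarrow> bool" where
  "admissible \<phi> B \<longleftrightarrow> profile \<phi> B \<and> even (\<phi> 0) \<and> (\<forall>c. \<bar>c\<bar> \<le> \<phi> c) \<and>
     (\<exists>M. \<forall>c. M \<le> \<bar>c\<bar> \<longrightarrow> \<phi> c = \<bar>c\<bar>)"

lemma admissible_raise:
  assumes "admissible \<phi> B"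
  shows "admissible (raise t \<phi>) (bead_step t B)"
proof -
  have p: "profile \<phi> B" and e: "even (\<phi> 0)" and ge: "\<And>c. \<bar>c\<bar> \<le> \<phi> c"
    using assms by (auto simp: admissible_def)
  obtain M where M: "\<And>c. M \<le> \<bar>c\<bar> \<Longrightarrow> \<phi> c = \<bar>c\<bar>"
    using assms by (auto simp: admissible_def)
  have "even (raise t \<phi> 0)" using e by (auto simp: raise_profile_eq[OF p])
  moreover have "\<bar>c\<bar> \<le> raise t \<phi> c" for c
    using ge[of c] by (auto simp: raise_profile_eq[OF p])
  moreover have "raise t \<phi> c = \<bar>c\<bar>" if "max M 0 + 1 \<le> \<bar>c\<bar>" for c
    using that M[of c] M[of "c - 1"] M[of "c + 1"] unfolding raise_def by auto
  ultimately show ?thesis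
    using profile_raise[OF p] unfolding admissible_def by blast
qed

text \<open>Going back by one in i or in j lowers i + j by 1 and shifts the content by 1, which a
  1-Lipschitz height can follow.\<close>

lemma below_profile_downward:
  assumes "profile \<phi> B" "i + j \<le> \<phi> (j - i)" "i' \<le> i" "j' \<le> j"
  shows "i' + j' \<le> \<phi> (j' - i')"
  using profile_lipschitz[OF assms(1), of "j - i" "j' - i'"] assms(2-4) by linarith

lemma young_diagram_of:
  assumes "admissible \<phi> B"
  shows "young_diagram (diagram_of \<phi>)"
proof -
  have p: "profile \<phi> B" and ge: "\<And>c. \<bar>c\<bar> \<le> \<phi> c"
    using assms by (auto simp: admissible_def)
  obtain M where M: "\<And>c. M \<le> \<bar>c\<bar> \<Longrightarrow> \<phi> c = \<bar>c\<bar>"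
    using assms by (auto simp: admissible_def)
  define L where "L = \<phi> 0 + \<bar>M\<bar>"
  have "diagram_of \<phi> \<subseteq> {..nat L} \<times> {..nat L}"
  proof safe
    fix i j assume "(i, j) \<in> diagram_of \<phi>"
    then have *: "1 \<le> i" "1 \<le> j" "int i + int j \<le> \<phi> (int j - int i)"
      by (auto simp: diagram_of_def)
    then have "\<not> M \<le> \<bar>int j - int i\<bar>" using M[of "int j - int i"] by auto
    with * have "int i + int j \<le> L"
      using profile_lipschitz[OF p, of "int j - int i" 0] unfolding L_def by linarith
    then show "i \<le> nat L" "j \<le> nat L" by auto
  qed
  then have "finite (diagram_of \<phi>)" by (rule finite_subset) auto
  moreover have "\<forall>(i, j)\<in>diagram_of \<phi>. \<forall>i' j'. 1 \<le> i' \<and> i' \<le> i \<and> 1 \<le> j' \<and> j' \<le> j \<longrightarrow>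
      (i', j') \<in> diagram_of \<phi>"
    unfolding diagram_of_def using below_profile_downward[OF p] by auto
  ultimately show ?thesis unfolding young_diagram_def by (auto simp: diagram_of_def)
qed

text \<open>The boxes above and to the left of a corner force the two slopes of a local minimum at
  its content. In the first row or column such a box is missing, and the bound
  \<open>\<bar>c\<bar> \<le> \<phi> c\<close> takes its place.\<close>

lemma growth_corner_diagram_of:
  assumes "admissible \<phi> B"
  shows "growth_corner (diagram_of \<phi>) (i, j) \<longleftrightarrow> 1 \<le> i \<and> 1 \<le> j \<and>
     int i + int j = \<phi> (int j - int i) + 2 \<and> int j - int i - 1 \<in> B \<and> int j - int i \<notin> B"
proof -
  have p: "profile \<phi> B" and e: "even (\<phi> 0)" and ge: "\<And>c. \<bar>c\<bar> \<le> \<phi> c"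
    using assms by (auto simp: admissible_def)
  have yd: "young_diagram (diagram_of \<phi>)" using assms by (rule young_diagram_of)
  define c where "c = int j - int i"
  have up: "\<phi> (c + 1) = \<phi> c + (if c \<in> B then - 1 else 1)"
    and dn: "\<phi> (c - 1) = \<phi> c + (if c - 1 \<in> B then 1 else - 1)"
    using profileD[OF p] profileD'[OF p] by auto
  show ?thesis
  proof
    assume "growth_corner (diagram_of \<phi>) (i, j)"
    then have out: "(i, j) \<notin> diagram_of \<phi>" and yi: "young_diagram (insert (i, j) (diagram_of \<phi>))"
      by (auto simp: growth_corner_def)
    have pos: "1 \<le> i" "1 \<le> j" using yi by (auto simp: young_diagram_def)
    with out have "\<phi> c < int i + int j" by (auto simp: diagram_of_def c_def)
    \<comment> \<open>Parity improves the strict inequality to a gap of at least 2.\<close>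
    moreover have "even (\<phi> c + c)" using profile_parity[OF p e] .
    ultimately have ge2: "\<phi> c + 2 \<le> int i + int j" unfolding c_def by presburger
    have down: "(i', j') \<in> insert (i, j) (diagram_of \<phi>)"
      if "1 \<le> i'" "i' \<le> i" "1 \<le> j'" "j' \<le> j" for i' j'
      using yi that unfolding young_diagram_def by blast
    have a: "int i + int j = \<phi> c + 2 \<and> c \<notin> B"
    proof (cases "i = 1")
      case True
      then show ?thesis using ge[of c] ge[of "c + 1"] up ge2 pos
        unfolding c_def by (auto split: if_splits)
    next
      case False
      then have "(i - 1, j) \<in> diagram_of \<phi>" using down[of "i - 1" j] pos by (cases "i - 1 = i") auto
      then have "int i - 1 + int j \<le> \<phi> (c + 1)" using pos
        by (auto simp: diagram_of_def c_def of_nat_diff algebra_simps)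
      then show ?thesis using up ge2 by (auto split: if_splits)
    qed
    have b: "c - 1 \<in> B"
    proof (cases "j = 1")
      case True
      then show ?thesis using ge[of c] ge[of "c - 1"] dn ge2 pos
        unfolding c_def by (auto split: if_splits)
    next
      case False
      then have "(i, j - 1) \<in> diagram_of \<phi>" using down[of i "j - 1"] pos by (cases "j - 1 = j") auto
      then have "int i + int j - 1 \<le> \<phi> (c - 1)" using pos
        by (auto simp: diagram_of_def c_def of_nat_diff algebra_simps)
      then show ?thesis using dn ge2 by (auto split: if_splits)
    qed
    show "1 \<le> i \<and> 1 \<le> j \<and> int i + int j = \<phi> (int j - int i) + 2 \<and>
        int j - int i - 1 \<in> B \<and> int j - int i \<notin> B"
      using a b pos unfolding c_def by simp
  next
    assume *: "1 \<le> i \<and> 1 \<le> j \<and> int i + int j = \<phi> (int j - int i) + 2 \<and>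
        int j - int i - 1 \<in> B \<and> int j - int i \<notin> B"
    have out: "(i, j) \<notin> diagram_of \<phi>" using * by (auto simp: diagram_of_def)
    have l: "(int i - 1) + int j \<le> \<phi> (int j - (int i - 1))"
      using * up by (simp add: c_def algebra_simps)
    have r: "int i + (int j - 1) \<le> \<phi> ((int j - 1) - int i)"
      using * dn by (simp add: c_def algebra_simps)
    have "(i', j') \<in> insert (i, j) (diagram_of \<phi>)"
      if "1 \<le> i'" "i' \<le> i" "1 \<le> j'" "j' \<le> j" for i' j'
    proof (cases "i' = i \<and> j' = j")
      case False
      then have "int i' \<le> int i - 1 \<and> int j' \<le> int j \<or> int i' \<le> int i \<and> int j' \<le> int j - 1"
        using that by linarith
      then have "int i' + int j' \<le> \<phi> (int j' - int i')"
        using below_profile_downward[OF p l] below_profile_downward[OF p r] by blast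
      then show ?thesis using that by (auto simp: diagram_of_def)
    qed simp
    then have "young_diagram (insert (i, j) (diagram_of \<phi>))"
      using yd * unfolding young_diagram_def by blast
    then show "growth_corner (diagram_of \<phi>) (i, j)" using out by (simp add: growth_corner_def)
  qed
qed

lemma growth_step_diagram_of:
  assumes "admissible \<phi> B"
  shows "growth_step n t (diagram_of \<phi>) = diagram_of (raise (int t) \<phi>)"
proof -
  have p: "profile \<phi> B" and e: "even (\<phi> 0)" and ge: "\<And>c. \<bar>c\<bar> \<le> \<phi> c"
    using assms by (auto simp: admissible_def)
  have "(i, j) \<in> growth_step n t (diagram_of \<phi>) \<longleftrightarrow> (i, j) \<in> diagram_of (raise (int t) \<phi>)" for i j
  proof -
    define c where "c = int j - int i"
    have "even (\<phi> c + c)" using profile_parity[OF p e] .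
    then have "int i + int j \<le> \<phi> c + 2 \<longleftrightarrow> int i + int j \<le> \<phi> c \<or> int i + int j = \<phi> c + 2"
      unfolding c_def by presburger
    then show ?thesis
      unfolding growth_step_def diagram_of_def Un_iff mem_Collect_eq prod.case
        growth_corner_diagram_of[OF assms, unfolded diagram_of_def] raise_profile_eq[OF p]
        box_content_def c_def[symmetric] fst_conv snd_conv
      by auto
  qed
  then show ?thesis by auto
qed

lemma card_growth_step_diagram_of:
  assumes "admissible \<phi> B"
  shows "card (growth_step n t (diagram_of \<phi>)) = card (diagram_of \<phi>) +
    card {c. c mod int n = int t \<and> c - 1 \<in> B \<and> c \<notin> B}"
proof -
  have p: "profile \<phi> B" and e: "even (\<phi> 0)" and ge: "\<And>c. \<bar>c\<bar> \<le> \<phi> c"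
    using assms by (auto simp: admissible_def)
  define G where "G = {b. growth_corner (diagram_of \<phi>) b \<and> box_content b mod int n = int t}"
  have "finite (growth_step n t (diagram_of \<phi>))"
    using young_diagram_of[OF admissible_raise[OF assms]]
    by (simp add: growth_step_diagram_of[OF assms] young_diagram_def)
  then have fin: "finite (diagram_of \<phi>)" "finite G" by (auto simp: growth_step_def G_def)
  have "diagram_of \<phi> \<inter> G = {}" by (auto simp: G_def growth_corner_def)
  then have "card (growth_step n t (diagram_of \<phi>)) = card (diagram_of \<phi>) + card G"
    using fin by (simp add: growth_step_def G_def card_Un_disjoint)
  moreover have "bij_betw box_content G {c. c mod int n = int t \<and> c - 1 \<in> B \<and> c \<notin> B}"
    unfolding bij_betw_def
  proof
    show "inj_on box_content G"
      unfolding inj_on_def G_def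
      by (auto simp: growth_corner_diagram_of[OF assms] box_content_def)
    show "box_content ` G = {c. c mod int n = int t \<and> c - 1 \<in> B \<and> c \<notin> B}"
    proof safe
      fix c assume c: "c mod int n = int t" "c - 1 \<in> B" "c \<notin> B"
      have "even (\<phi> c + c)" using profile_parity[OF p e] .
      \<comment> \<open>The column and row with content c and i + j equal to \<open>\<phi> c\<close>
        are d and d - c; the corner is one step further along the diagonal.\<close>
      then obtain d where d: "\<phi> c + c = 2 * d" by (rule evenE)
      have "- c \<le> d - c" "c \<le> d" "0 \<le> d" using d ge[of c] by linarith+
      then have "growth_corner (diagram_of \<phi>) (nat (d - c + 1), nat (d + 1))"
        unfolding growth_corner_diagram_of[OF assms] using c d by auto
      moreover have "box_content (nat (d - c + 1), nat (d + 1)) = c"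
        using \<open>c \<le> d\<close> \<open>0 \<le> d\<close> by (simp add: box_content_def)
      ultimately show "c \<in> box_content ` G" unfolding G_def using c(1) by force
    qed (auto simp: G_def growth_corner_diagram_of[OF assms] box_content_def)
  qed
  ultimately show ?thesis by (simp add: bij_betw_same_card)
qed

text \<open>\<open>a i\<close> is the first empty position on its runner, the positions congruent to it modulo \<open>n\<close>.
  The labels keep the order of the levels, so the runner of a label changes with time.\<close>

definition level_step :: "int \<Rightarrow> (nat \<Rightarrow> int) \<Rightarrow> nat \<Rightarrow> int" where
  "level_step t a = (\<lambda>k.
     if a k mod int n = (t - 1) mod int n \<and> (\<exists>j<n. a j mod int n = t \<and> a j < a k) then a k + 1
     else if a k mod int n = t \<and> (\<exists>i<n. a i mod int n = (t - 1) mod int n \<and> a k < a i) then a k - 1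
     else a k)"

definition levels :: "(nat \<Rightarrow> int) \<Rightarrow> bool" where
  "levels a \<longleftrightarrow> strict_mono_on {..<n} a \<and> bij_betw (\<lambda>i. a i mod int n) {..<n} {0..<int n}"

definition beads :: "(nat \<Rightarrow> int) \<Rightarrow> int set" where
  "beads a = {c. \<exists>i<n. a i mod int n = c mod int n \<and> c < a i}"

text \<open>On each runner the summand counts the beads at or above c or the gaps below c, only one
  of which can be nonzero; the sum is the usual height of the Maya diagram.\<close>

definition height :: "(nat \<Rightarrow> int) \<Rightarrow> int \<Rightarrow> int" where
  "height a = (\<lambda>c. \<Sum>i<n. \<bar>(a i - c) div int n\<bar>)"

definition top_residues :: "nat \<Rightarrow> (nat \<Rightarrow> int) \<Rightarrow> int set" where
  "top_residues k a = (\<lambda>i. a i mod int n) ` {k..<n}"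

definition jumps :: "int \<Rightarrow> int set \<Rightarrow> bool" where
  "jumps t Y \<longleftrightarrow> (t - 1) mod int n \<in> Y \<and> t \<notin> Y"

definition ring_step :: "int \<Rightarrow> int set \<Rightarrow> int set" where
  "ring_step t Y = (if jumps t Y then insert t (Y - {(t - 1) mod int n}) else Y)"

lemma levels_inj:
  "levels a \<Longrightarrow> i < n \<Longrightarrow> j < n \<Longrightarrow> a i mod int n = a j mod int n \<Longrightarrow> i = j"
  unfolding levels_def bij_betw_def inj_on_def by blast

lemma levels_less: "levels a \<Longrightarrow> i < n \<Longrightarrow> j < n \<Longrightarrow> a i < a j \<longleftrightarrow> i < j"
  unfolding levels_def by (auto simp: strict_mono_on_less)

lemma levels_ex:
  assumes "levels a"
  obtains i where "i < n" "a i mod int n = c mod int n"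
proof -
  have "c mod int n \<in> (\<lambda>i. a i mod int n) ` {..<n}"
    using assms n_ge_2 by (auto simp: levels_def bij_betw_def)
  then show ?thesis using that by auto
qed

lemma pred_mod_neq: "t \<in> {0..<int n} \<Longrightarrow> (t - 1) mod int n \<noteq> t"
  using mod_Suc_neq[of "t - 1" t] by auto

lemma pred_mod_iff: "t \<in> {0..<int n} \<Longrightarrow> c mod int n = (t - 1) mod int n \<longleftrightarrow> (c + 1) mod int n = t"
proof -
  assume t: "t \<in> {0..<int n}"
  have "c mod int n = (t - 1) mod int n \<longleftrightarrow> (c + 1) mod int n = t mod int n"
    by (simp add: mod_eq_dvd_iff algebra_simps)
  then show ?thesis using t by simp
qed

text \<open>A step at t concerns only the runners t - 1 and t, with levels \<open>a i\<close> and
  \<open>a j\<close>. After it, runner t ends at the maximum of \<open>a j\<close> and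
  \<open>a i + 1\<close>, and runner t - 1 at the minimum of \<open>a i\<close> and
  \<open>a j - 1\<close>. If \<open>a j < a i\<close>, the labels change runners, so that the larger
  level keeps the larger label.\<close>

lemma level_step_cases:
  assumes "levels a" and t: "t \<in> {0..<int n}"
  obtains i j where "i < n" "j < n" "i \<noteq> j" "a i mod int n = (t - 1) mod int n" "a j mod int n = t"
    "a j < a i \<Longrightarrow> \<forall>k<n. level_step t a k = (a(i := a i + 1, j := a j - 1)) k"
    "\<not> a j < a i \<Longrightarrow> \<forall>k<n. level_step t a k = a k"
proof -
  obtain i where i: "i < n" "a i mod int n = (t - 1) mod int n" using levels_ex[OF assms(1)] .
  obtain j where j: "j < n" "a j mod int n = t mod int n" using levels_ex[OF assms(1)] .
  have j': "a j mod int n = t" using j t by simp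
  have ne: "i \<noteq> j" using i j' pred_mod_neq[OF t] by auto
  have ui: "k < n \<Longrightarrow> a k mod int n = (t - 1) mod int n \<longleftrightarrow> k = i" for k
    using levels_inj[OF assms(1)] i by metis
  have uj: "k < n \<Longrightarrow> a k mod int n = t \<longleftrightarrow> k = j" for k
    using levels_inj[OF assms(1)] j(1) j' by metis
  show ?thesis
  proof (rule that[of i j])
    show "\<forall>k<n. level_step t a k = (a(i := a i + 1, j := a j - 1)) k" if "a j < a i"
      using that ui uj ne i(1) j(1) unfolding level_step_def by auto
    show "\<forall>k<n. level_step t a k = a k" if "\<not> a j < a i"
      using that ui uj ne i(1) j(1) unfolding level_step_def by auto
  qed (use i j(1) j' ne in auto)
qed

lemma levels_cong: "(\<And>k. k < n \<Longrightarrow> a k = b k) \<Longrightarrow> levels a \<longleftrightarrow> levels b"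
  unfolding levels_def strict_mono_on_def
  by (intro arg_cong2[of _ _ _ _ "(\<and>)"] bij_betw_cong) auto

text \<open>An exchange composes the residue bijection with a transposition. The order could only
  fail if \<open>a i + 1\<close> or \<open>a j - 1\<close> were the level of another label, but
  these numbers have the residues of \<open>a j\<close> and \<open>a i\<close>.\<close>

lemma levels_level_step:
  assumes "levels a" and t: "t \<in> {0..<int n}"
  shows "levels (level_step t a)"
proof -
  obtain i j where ij: "i < n" "j < n" "i \<noteq> j" "a i mod int n = (t - 1) mod int n" "a j mod int n = t"
    and l: "a j < a i \<Longrightarrow> \<forall>k<n. level_step t a k = (a(i := a i + 1, j := a j - 1)) k"
    and r: "\<not> a j < a i \<Longrightarrow> \<forall>k<n. level_step t a k = a k"
    using level_step_cases[OF assms] by metis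
  show ?thesis
  proof (cases "a j < a i")
    case True
    define b where "b = a(i := a i + 1, j := a j - 1)"
    have mi: "(a i + 1) mod int n = t" using ij(4) pred_mod_iff[OF t] by simp
    have mj: "(a j - 1) mod int n = (t - 1) mod int n" using ij(5) by (metis mod_diff_left_eq)
    have "b k mod int n = a (Transposition.transpose i j k) mod int n" for k
      using ij mi mj by (auto simp: b_def Transposition.transpose_def)
    then have "bij_betw (\<lambda>k. b k mod int n) {..<n} {0..<int n} \<longleftrightarrow>
      bij_betw ((\<lambda>k. a k mod int n) \<circ> Transposition.transpose i j) {..<n} {0..<int n}"
      by (intro bij_betw_cong) auto
    moreover have "bij_betw (Transposition.transpose i j) {..<n} {..<n}"
      using ij by (intro bij_betw_byWitness[where f' = "Transposition.transpose i j"])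
        (auto simp: Transposition.transpose_def)
    ultimately have "bij_betw (\<lambda>k. b k mod int n) {..<n} {0..<int n}"
      using assms(1) by (metis bij_betw_trans levels_def)
    moreover have "strict_mono_on {..<n} b"
    proof (rule strict_mono_onI)
      fix k l assume kl: "k \<in> {..<n}" "l \<in> {..<n}" "k < l"
      then have less: "a k < a l" using levels_less[OF assms(1)] by auto
      have "a l \<noteq> a i + 1" using kl True mi ij levels_inj[OF assms(1), of l j] by auto
      moreover have "a k \<noteq> a j - 1" using kl True mj ij levels_inj[OF assms(1), of k i] by auto
      ultimately show "b k < b l" using less True ij(3) unfolding b_def by auto
    qed
    ultimately have "levels b" unfolding levels_def by blast
    then show ?thesis using levels_cong[of "level_step t a" b] l[OF True] by (simp add: b_def)
  next
    case False
    then show ?thesis using levels_cong[of "level_step t a" a] r[OF False] assms by simp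
  qed
qed

lemma mem_beads_iff:
  assumes "levels a" "i < n" "a i mod int n = c mod int n"
  shows "c \<in> beads a \<longleftrightarrow> c < a i"
proof
  assume "c \<in> beads a"
  then obtain k where k: "k < n" "a k mod int n = c mod int n" "c < a k" by (auto simp: beads_def)
  then have "k = i" using levels_inj[OF assms(1) k(1) assms(2)] assms(3) by simp
  then show "c < a i" using k by simp
qed (use assms in \<open>auto simp: beads_def\<close>)

lemma beads_level_step:
  assumes "levels a" and t: "t \<in> {0..<int n}"
  shows "beads (level_step t a) = bead_step t (beads a)"
proof (rule set_eqI)
  fix c
  obtain i j where ij: "i < n" "j < n" "i \<noteq> j" "a i mod int n = (t - 1) mod int n" "a j mod int n = t"
    and l: "a j < a i \<Longrightarrow> \<forall>k<n. level_step t a k = (a(i := a i + 1, j := a j - 1)) k"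
    and r: "\<not> a j < a i \<Longrightarrow> \<forall>k<n. level_step t a k = a k"
    using level_step_cases[OF assms] by metis
  have t': "t mod int n = t" using t by simp
  note lev = levels_level_step[OF assms]
  have mi: "(a i + 1) mod int n = t" using ij(4) pred_mod_iff[OF t] by simp
  have mj: "(a j - 1) mod int n = (t - 1) mod int n" using ij(5) by (metis mod_diff_left_eq)
  have ne: "a i \<noteq> a j" using ij pred_mod_neq[OF t] by auto
  show "c \<in> beads (level_step t a) \<longleftrightarrow> c \<in> bead_step t (beads a)"
  proof (cases "c mod int n = t")
    case True
    have b1: "c \<in> beads a \<longleftrightarrow> c < a j" using mem_beads_iff[OF assms(1) ij(2)] ij(5) True by simp
    have "(c - 1) mod int n = (t - 1) mod int n" using True by (metis mod_diff_left_eq)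
    then have b2: "c - 1 \<in> beads a \<longleftrightarrow> c - 1 < a i"
      using mem_beads_iff[OF assms(1) ij(1)] ij(4) by simp
    have "c \<in> beads (level_step t a) \<longleftrightarrow> c < a j \<or> c - 1 < a i"
    proof (cases "a j < a i")
      case less: True
      then have "level_step t a i = a i + 1" using l ij by auto
      then show ?thesis using mem_beads_iff[OF lev ij(1), of c] mi True less by auto
    next
      case False
      then have "level_step t a j = a j" using r ij by auto
      then show ?thesis using mem_beads_iff[OF lev ij(2), of c] ij(5) True False ne by auto
    qed
    then show ?thesis using True b1 b2 by (auto simp: bead_step_def)
  next
    case False
    show ?thesis
    proof (cases "(c + 1) mod int n = t")
      case True
      then have cm: "c mod int n = (t - 1) mod int n" using pred_mod_iff[OF t] by simp
      have b1: "c \<in> beads a \<longleftrightarrow> c < a i" using mem_beads_iff[OF assms(1) ij(1)] ij(4) cm by simp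
      have b2: "c + 1 \<in> beads a \<longleftrightarrow> c + 1 < a j"
        using mem_beads_iff[OF assms(1) ij(2)] ij(5) True by simp
      have "c \<in> beads (level_step t a) \<longleftrightarrow> c < a i \<and> c + 1 < a j"
      proof (cases "a j < a i")
        case less: True
        then have "level_step t a j = a j - 1" using l ij by auto
        then show ?thesis using mem_beads_iff[OF lev ij(2), of c] mj cm less by auto
      next
        case False
        then have "level_step t a i = a i" using r ij by auto
        moreover have "a i + 1 \<le> a j" using False ne by simp
        ultimately show ?thesis using mem_beads_iff[OF lev ij(1), of c] ij(4) cm by auto
      qed
      then show ?thesis using True False b1 b2 by (auto simp: bead_step_def)
    next
      case F2: False
      obtain k where k: "k < n" "a k mod int n = c mod int n" using levels_ex[OF assms(1)] .
      have "k \<noteq> i" "k \<noteq> j" using k ij False F2 pred_mod_iff[OF t, of c] by auto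
      then have "level_step t a k = a k" using l r k by (cases "a j < a i") auto
      then have "c \<in> beads (level_step t a) \<longleftrightarrow> c \<in> beads a"
        using mem_beads_iff[OF lev k(1), of c] mem_beads_iff[OF assms(1) k(1), of c] k(2) by simp
      then show ?thesis using False F2 by (simp add: bead_step_def)
    qed
  qed
qed

text \<open>The quotient drops exactly when c passes a position on the runner of a. This is what
  makes both \<open>height\<close> and \<open>ring_height\<close> profiles.\<close>

lemma div_Suc_diff:
  "(a - (c + 1)) div int n = (a - c) div int n - (if a mod int n = c mod int n then 1 else 0)"
proof -
  have n0: "0 < int n" using n_ge_2 by simp
  have *: "a mod int n = c mod int n \<longleftrightarrow> (a - c) mod int n = 0"
    by (simp add: mod_eq_dvd_iff dvd_eq_mod_eq_0)
  define x where "x = a - c"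
  have "(x - 1) div int n = x div int n - (if x mod int n = 0 then 1 else 0)"
  proof -
    have x: "x = int n * (x div int n) + x mod int n" by simp
    have m: "0 \<le> x mod int n" "x mod int n < int n" using n0 by auto
    show ?thesis
    proof (cases "x mod int n = 0")
      case True
      have "(x - 1) div int n = x div int n - 1"
        by (rule int_div_pos_eq[where r = "int n - 1"]) (use x True n0 in \<open>auto simp: algebra_simps\<close>)
      then show ?thesis using True by simp
    next
      case False
      with m have "1 \<le> x mod int n" "x mod int n < 1 + int n" by linarith+
      then have "(x - 1) div int n = x div int n"
        by (intro int_div_pos_eq[where r = "x mod int n - 1"])
          (use x in \<open>simp_all add: algebra_simps del: pos_mod_bound pos_mod_sign\<close>)
      then show ?thesis using False by simp
    qed
  qed
  then show ?thesis unfolding * x_def by (simp add: algebra_simps)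
qed

lemma profile_height:
  assumes "levels a"
  shows "profile (height a) (beads a)"
  unfolding profile_def
proof
  fix c
  obtain k where k: "k < n" "a k mod int n = c mod int n" using levels_ex[OF assms] .
  have u: "i < n \<Longrightarrow> a i mod int n = c mod int n \<longleftrightarrow> i = k" for i
    using levels_inj[OF assms] k by metis
  have dv: "int n dvd a k - c" using k(2) by (simp add: mod_eq_dvd_iff)
  have "height a (c + 1) = (\<Sum>i<n. \<bar>(a i - c) div int n - (if i = k then 1 else 0)\<bar>)"
    unfolding height_def div_Suc_diff by (intro sum.cong) (auto simp: u)
  also have "\<dots> = (\<Sum>i<n. \<bar>(a i - c) div int n\<bar> +
     (if i = k then (if c < a k then - 1 else 1) else 0))"
  proof (intro sum.cong refl)
    fix i assume "i \<in> {..<n}"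
    show "\<bar>(a i - c) div int n - (if i = k then 1 else 0)\<bar> = \<bar>(a i - c) div int n\<bar> +
       (if i = k then (if c < a k then - 1 else 1) else 0)"
    proof (cases "i = k")
      case True
      obtain q where q: "a k - c = int n * q" using dv by (rule dvdE)
      have n0: "0 < int n" using n_ge_2 by simp
      have "c < a k \<longleftrightarrow> 0 < int n * q" using q by linarith
      then have "c < a k \<longleftrightarrow> 0 < q" using n0 by (simp add: zero_less_mult_iff)
      then show ?thesis using True q n0 by auto
    qed simp
  qed
  also have "\<dots> = height a c + (if c < a k then - 1 else 1)"
    using k(1) by (simp add: sum.distrib height_def)
  finally show "height a (c + 1) = height a c + (if c \<in> beads a then - 1 else 1)"
    using mem_beads_iff[OF assms k] by simp
qed

text \<open>Both sides have the same beads, so agreement at one content suffices. At t + 1 nothing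
  is raised, and the quotients of the two moved levels do not change there.\<close>

lemma height_level_step:
  assumes "levels a" and t: "t \<in> {0..<int n}"
  shows "height (level_step t a) = raise t (height a)"
proof (rule profile_unique)
  show "profile (height (level_step t a)) (bead_step t (beads a))"
    using profile_height[OF levels_level_step[OF assms]] beads_level_step[OF assms] by simp
  show "profile (raise t (height a)) (bead_step t (beads a))"
    by (rule profile_raise[OF profile_height[OF assms(1)]])
  obtain i j where ij: "i < n" "j < n" "i \<noteq> j" "a i mod int n = (t - 1) mod int n" "a j mod int n = t"
    and l: "a j < a i \<Longrightarrow> \<forall>k<n. level_step t a k = (a(i := a i + 1, j := a j - 1)) k"
    and r: "\<not> a j < a i \<Longrightarrow> \<forall>k<n. level_step t a k = a k"
    using level_step_cases[OF assms] by metis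
  have c: "(t + 1) mod int n \<noteq> t" using mod_Suc_neq[of t t] t by auto
  have mi: "(a i + 1) mod int n = t" using ij(4) pred_mod_iff[OF t] by simp
  have tm: "t mod int n = t" using t by simp
  have "(a i + 1 - (t + 1)) div int n = (a i - (t + 1)) div int n"
    using div_Suc_diff[of "a i" t] ij(4) pred_mod_neq[OF t] tm by (auto simp: algebra_simps)
  moreover have "(a j - 1 - (t + 1)) div int n = (a j - (t + 1)) div int n"
    using div_Suc_diff[of "a j" "t + 1"] ij(5) c by (auto simp: algebra_simps)
  ultimately have "(level_step t a k - (t + 1)) div int n = (a k - (t + 1)) div int n" if "k < n" for k
    using l r that by (cases "a j < a i") (auto simp: fun_upd_def)
  then have "height (level_step t a) (t + 1) = height a (t + 1)"
    unfolding height_def by (intro sum.cong) auto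
  then show "height (level_step t a) (t + 1) = raise t (height a) (t + 1)"
    using c by (simp add: raise_def)
qed

text \<open>An exchange within the top labels permutes their residues and preserves the sum; one
  among the remaining labels is invisible. Only an exchange across the threshold matters, and a
  particle at t - 1 with a hole at t means j < k <= i, which already implies
  \<open>a j < a i\<close>.\<close>

lemma top_residues_level_step:
  assumes "levels a" and t: "t \<in> {0..<int n}"
  shows "top_residues k (level_step t a) = ring_step t (top_residues k a)"
    and "(\<Sum>i = k..<n. level_step t a i) = (\<Sum>i = k..<n. a i) + of_bool (jumps t (top_residues k a))"
proof -
  obtain i j where ij: "i < n" "j < n" "i \<noteq> j" "a i mod int n = (t - 1) mod int n" "a j mod int n = t"
    and l: "a j < a i \<Longrightarrow> \<forall>k<n. level_step t a k = (a(i := a i + 1, j := a j - 1)) k"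
    and r: "\<not> a j < a i \<Longrightarrow> \<forall>k<n. level_step t a k = a k"
    using level_step_cases[OF assms] by metis
  have mi: "(a i + 1) mod int n = t" using ij(4) pred_mod_iff[OF t] by simp
  have mj: "(a j - 1) mod int n = (t - 1) mod int n" using ij(5) by (metis mod_diff_left_eq)
  have mem: "a l mod int n \<in> top_residues k a \<longleftrightarrow> k \<le> l" if "l < n" for l
  proof
    assume "a l mod int n \<in> top_residues k a"
    then obtain m where "k \<le> m" "m < n" "a l mod int n = a m mod int n"
      by (auto simp: top_residues_def)
    then show "k \<le> l" using levels_inj[OF assms(1) that, of m] by simp
  qed (use that in \<open>auto simp: top_residues_def\<close>)
  have jmp: "jumps t (top_residues k a) \<longleftrightarrow> k \<le> i \<and> j < k"
    using mem[OF ij(1)] mem[OF ij(2)] unfolding jumps_def ij(4) ij(5) by auto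
  show "top_residues k (level_step t a) = ring_step t (top_residues k a)"
  proof (cases "a j < a i")
    case less: True
    define b where "b = a(i := a i + 1, j := a j - 1)"
    have bi: "b i mod int n = t" and bj: "b j mod int n = (t - 1) mod int n"
      using ij mi mj by (auto simp: b_def)
    have b: "top_residues k (level_step t a) = top_residues k b"
      unfolding top_residues_def using l[OF less] by (intro image_cong) (auto simp: b_def)
    have ji: "j < i" using levels_less[OF assms(1)] ij less by simp
    have bo: "b l = a l" if "l \<noteq> i" "l \<noteq> j" for l using that by (simp add: b_def)
    consider "k \<le> j" | "j < k" "k \<le> i" | "i < k" by linarith
    then show ?thesis
    proof cases
      case 1
      then have s: "{k..<n} = insert i (insert j ({k..<n} - {i, j}))" using ij ji by auto
      have "top_residues k b = insert t (insert ((t - 1) mod int n) ((\<lambda>l. a l mod int n) ` ({k..<n} - {i, j})))"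
        unfolding top_residues_def by (subst s) (auto simp: bi bj bo)
      moreover have "top_residues k a = insert t (insert ((t - 1) mod int n) ((\<lambda>l. a l mod int n) ` ({k..<n} - {i, j})))"
        unfolding top_residues_def by (subst s) (auto simp: ij)
      ultimately show ?thesis using b jmp 1 by (simp add: ring_step_def)
    next
      case 2
      then have s: "{k..<n} = insert i ({k..<n} - {i})" and nj: "j \<notin> {k..<n} - {i}" using ij by auto
      have "top_residues k b = insert t ((\<lambda>l. a l mod int n) ` ({k..<n} - {i}))"
      proof -
        have "(\<lambda>l. b l mod int n) ` ({k..<n} - {i}) = (\<lambda>l. a l mod int n) ` ({k..<n} - {i})"
        proof (intro image_cong refl)
          fix l assume "l \<in> {k..<n} - {i}"
          then have "l \<noteq> i" "l \<noteq> j" using nj by auto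
          then show "b l mod int n = a l mod int n" by (simp add: bo)
        qed
        moreover have "top_residues k b = (\<lambda>l. b l mod int n) ` insert i ({k..<n} - {i})"
          unfolding top_residues_def by (rule arg_cong[OF s])
        ultimately show ?thesis by (simp only: image_insert bi)
      qed
      moreover have "(\<lambda>l. a l mod int n) ` ({k..<n} - {i}) = top_residues k a - {(t - 1) mod int n}"
      proof -
        have "inj_on (\<lambda>l. a l mod int n) {..<n}"
          using assms(1) by (simp add: levels_def bij_betw_def)
        moreover have "{k..<n} - {i} \<subseteq> {..<n}" "{i} \<subseteq> {..<n}" using ij(1) by auto
        ultimately have "(\<lambda>l. a l mod int n) ` ({k..<n} - {i}) =
            (\<lambda>l. a l mod int n) ` {k..<n} - (\<lambda>l. a l mod int n) ` {i}"
          by (rule inj_on_image_set_diff)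
        then show ?thesis by (simp only: top_residues_def image_insert image_empty ij(4))
      qed
      ultimately show ?thesis using b jmp 2 by (simp add: ring_step_def)
    next
      case 3
      then have "top_residues k b = top_residues k a"
        unfolding top_residues_def using ji by (intro image_cong) (auto simp: bo)
      then show ?thesis using b jmp 3 by (simp add: ring_step_def)
    qed
  next
    case False
    then have "i < j" using levels_less[OF assms(1)] ij by auto
    moreover have "top_residues k (level_step t a) = top_residues k a"
      unfolding top_residues_def using r[OF False] by (intro image_cong) auto
    moreover have "\<not> jumps t (top_residues k a)" using jmp calculation(1) by linarith
    ultimately show ?thesis by (simp add: ring_step_def)
  qed
  show "(\<Sum>i = k..<n. level_step t a i) = (\<Sum>i = k..<n. a i) + of_bool (jumps t (top_residues k a))"
  proof (cases "a j < a i")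
    case less: True
    have "(\<Sum>l = k..<n. level_step t a l) =
      (\<Sum>l = k..<n. a l + (if l = i then 1 else 0) - (if l = j then 1 else 0))"
      using l[OF less] ij by (intro sum.cong) auto
    also have "\<dots> = (\<Sum>l = k..<n. a l) + of_bool (k \<le> i) - of_bool (k \<le> j)"
      using ij by (simp add: sum.distrib sum_subtractf)
    moreover have "j < i" using levels_less[OF assms(1)] ij less by simp
    ultimately show ?thesis unfolding jmp by (auto simp: of_bool_def)
  next
    case False
    then have "i < j" using levels_less[OF assms(1)] ij by auto
    moreover have "(\<Sum>l = k..<n. level_step t a l) = (\<Sum>l = k..<n. a l)"
      using r[OF False] by (intro sum.cong) auto
    ultimately show ?thesis unfolding jmp by auto
  qed
qed

text \<open>An exchange changes the sum of squares by 2 (a i + 1 - a j). The contents that gain a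
  box are those congruent to t from \<open>a j\<close> to \<open>a i\<close>, and there are (a i + 1
  - a j) / n of them.\<close>

lemma sum_squares_level_step:
  assumes "levels a" and t: "t \<in> {0..<int n}"
  shows "(\<Sum>i<n. (level_step t a i)\<^sup>2) = (\<Sum>i<n. (a i)\<^sup>2) +
    2 * int n * int (card {c. c mod int n = t \<and> c - 1 \<in> beads a \<and> c \<notin> beads a})"
proof -
  obtain i j where ij: "i < n" "j < n" "i \<noteq> j" "a i mod int n = (t - 1) mod int n" "a j mod int n = t"
    and l: "a j < a i \<Longrightarrow> \<forall>k<n. level_step t a k = (a(i := a i + 1, j := a j - 1)) k"
    and r: "\<not> a j < a i \<Longrightarrow> \<forall>k<n. level_step t a k = a k"
    using level_step_cases[OF assms] by metis
  have mi: "(a i + 1) mod int n = t" using ij(4) pred_mod_iff[OF t] by simp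
  have n0: "0 < int n" using n_ge_2 by simp
  have "c \<notin> beads a \<longleftrightarrow> a j \<le> c" "c - 1 \<in> beads a \<longleftrightarrow> c \<le> a i" if "c mod int n = t" for c
  proof -
    show "c \<notin> beads a \<longleftrightarrow> a j \<le> c"
      using mem_beads_iff[OF assms(1) ij(2)] ij(5) that by auto
    have "(c - 1) mod int n = (t - 1) mod int n" using that by (metis mod_diff_left_eq)
    then show "c - 1 \<in> beads a \<longleftrightarrow> c \<le> a i"
      using mem_beads_iff[OF assms(1) ij(1)] ij(4) by auto
  qed
  then have S: "{c. c mod int n = t \<and> c - 1 \<in> beads a \<and> c \<notin> beads a} =
      {c. c mod int n = t \<and> a j \<le> c \<and> c \<le> a i}" by blast
  show ?thesis
  proof (cases "a j < a i")
    case less: True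
    have "int n dvd (a i + 1) - a j" using mi ij(5) mod_eq_dvd_iff by metis
    then obtain q where q: "a i + 1 - a j = int n * q" by (rule dvdE)
    have "0 < int n * q" using q less by linarith
    then have q0: "0 < q" using n0 by (simp add: zero_less_mult_iff)
    have "{c. c mod int n = t \<and> a j \<le> c \<and> c \<le> a i} = (\<lambda>l. a j + int n * l) ` {0..<q}"
    proof (intro equalityI subsetI)
      fix c assume c: "c \<in> {c. c mod int n = t \<and> a j \<le> c \<and> c \<le> a i}"
      then have "c mod int n = a j mod int n" using ij(5) by simp
      then have "int n dvd c - a j" by (simp only: mod_eq_dvd_iff)
      then obtain l where l: "c - a j = int n * l" by (rule dvdE)
      have "0 \<le> int n * l" "int n * l < int n * q" using c l q by auto
      then have "l \<in> {0..<q}" using n0 by (simp add: zero_le_mult_iff)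
      moreover have "c = a j + int n * l" using l by simp
      ultimately show "c \<in> (\<lambda>l. a j + int n * l) ` {0..<q}" by blast
    next
      fix c assume "c \<in> (\<lambda>l. a j + int n * l) ` {0..<q}"
      then obtain l where l: "0 \<le> l" "l < q" "c = a j + int n * l" by auto
      have "int n * l < int n * q" using l n0 by simp
      then show "c \<in> {c. c mod int n = t \<and> a j \<le> c \<and> c \<le> a i}" using l q ij(5) by auto
    qed
    moreover have "inj_on (\<lambda>l. a j + int n * l) {0..<q}" using n0 by (auto simp: inj_on_def)
    ultimately have cd: "int (card {c. c mod int n = t \<and> a j \<le> c \<and> c \<le> a i}) = q"
      using q0 by (simp add: card_image)
    have "(\<Sum>k<n. (level_step t a k)\<^sup>2) =
      (\<Sum>k<n. (a k)\<^sup>2 + (if k = i then 2 * a i + 1 else 0) + (if k = j then 1 - 2 * a j else 0))"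
      using l[OF less] ij by (intro sum.cong) (auto simp: power2_eq_square algebra_simps)
    also have "\<dots> = (\<Sum>k<n. (a k)\<^sup>2) + (2 * a i + 1) + (1 - 2 * a j)"
      using ij by (simp add: sum.distrib)
    also have "\<dots> = (\<Sum>k<n. (a k)\<^sup>2) + 2 * (a i + 1 - a j)" by simp
    finally show ?thesis unfolding S cd q by (simp add: algebra_simps)
  next
    case False
    moreover have "a i \<noteq> a j" using ij pred_mod_neq[OF t] by auto
    ultimately have "{c. c mod int n = t \<and> a j \<le> c \<and> c \<le> a i} = {}" by auto
    moreover have "(\<Sum>k<n. (level_step t a k)\<^sup>2) = (\<Sum>k<n. (a k)\<^sup>2)"
      using r[OF False] by (intro sum.cong) auto
    ultimately show ?thesis unfolding S by simp
  qed
qed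

section \<open>The empty core and the invariants of a run\<close>

lemma levels_int: "levels int"
proof -
  have "bij_betw (\<lambda>i. int i mod int n) {..<n} {0..<int n}"
    by (rule bij_betw_byWitness[where f' = nat]) auto
  then show ?thesis unfolding levels_def by (auto simp: strict_mono_on_def)
qed

lemma height_int: "height int = abs"
proof (rule profile_unique)
  show "profile (height int) (beads int)" by (rule profile_height[OF levels_int])
  have "c \<in> beads int \<longleftrightarrow> c < 0" for c
  proof -
    have "int (nat (c mod int n)) mod int n = c mod int n" "nat (c mod int n) < n"
      using n_ge_2 by (auto simp: nat_less_iff)
    then have "c \<in> beads int \<longleftrightarrow> c < c mod int n"
      using mem_beads_iff[OF levels_int, of "nat (c mod int n)" c] n_ge_2 by auto
    also have "\<dots> \<longleftrightarrow> c < 0"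
    proof
      assume "c < c mod int n"
      then show "c < 0"
        using zmod_le_nonneg_dividend[of c "int n"] by linarith
    next
      assume "c < 0"
      then show "c < c mod int n" using n_ge_2 pos_mod_sign[of "int n" c] by linarith
    qed
    finally show ?thesis .
  qed
  then show "profile abs (beads int)" unfolding profile_def by auto
  show "height int 0 = \<bar>0\<bar>" by (simp add: height_def)
qed

lemma admissible_abs: "admissible (height int) (beads int)"
  using profile_height[OF levels_int] unfolding admissible_def height_int by auto

lemma diagram_of_abs: "diagram_of (height int) = {}"
  unfolding height_int diagram_of_def by auto

definition core_levels :: "nat list \<Rightarrow> nat \<Rightarrow> int" where
  "core_levels ts = fold (\<lambda>t. level_step (int t)) ts int"

lemma core_levels_snoc: "core_levels (ts @ [t]) = level_step (int t) (core_levels ts)"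
  by (simp add: core_levels_def)

lemma core_levels_invariants:
  assumes "set ts \<subseteq> {0..<n}"
  shows "levels (core_levels ts)"
    and "admissible (height (core_levels ts)) (beads (core_levels ts))"
    and "fold (growth_step n) ts {} = diagram_of (height (core_levels ts))"
    and "(\<Sum>i<n. (core_levels ts i)\<^sup>2) =
      (\<Sum>i<n. (int i)\<^sup>2) + 2 * int n * int (card (diagram_of (height (core_levels ts))))"
  using assms
proof (induction ts rule: rev_induct)
  case Nil
  {
    case 1 show ?case by (simp add: core_levels_def levels_int)
  next
    case 2 show ?case by (simp add: core_levels_def admissible_abs)
  next
    case 3 show ?case by (simp add: core_levels_def diagram_of_abs)
  next
    case 4 show ?case by (simp add: core_levels_def diagram_of_abs)
  }
next
  case (snoc t ts)
  let ?a = "core_levels ts"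
  {
    case 1
    then show ?case using snoc levels_level_step unfolding core_levels_snoc by simp
  next
    case 2
    then have t: "int t \<in> {0..<int n}" and l: "levels ?a" and ad: "admissible (height ?a) (beads ?a)"
      using snoc by auto
    show ?case
      using admissible_raise[OF ad, of "int t"] height_level_step[OF l t] beads_level_step[OF l t]
      by (simp add: core_levels_snoc)
  next
    case 3
    then have t: "int t \<in> {0..<int n}" and l: "levels ?a" and ad: "admissible (height ?a) (beads ?a)"
      and eq: "fold (growth_step n) ts {} = diagram_of (height ?a)"
      using snoc by auto
    show ?case
      using growth_step_diagram_of[OF ad, of t] height_level_step[OF l t] eq
      by (simp add: core_levels_snoc)
  next
    case 4
    then have t: "int t \<in> {0..<int n}" and l: "levels ?a" and ad: "admissible (height ?a) (beads ?a)"
      and sq: "(\<Sum>i<n. (?a i)\<^sup>2) = (\<Sum>i<n. (int i)\<^sup>2) + 2 * int n * int (card (diagram_of (height ?a)))"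
      using snoc by auto
    have "card (diagram_of (height (level_step (int t) ?a))) = card (diagram_of (height ?a)) +
      card {c. c mod int n = int t \<and> c - 1 \<in> beads ?a \<and> c \<notin> beads ?a}"
      using card_growth_step_diagram_of[OF ad, of t] growth_step_diagram_of[OF ad, of t]
        height_level_step[OF l t] by simp
    then show ?case
      using sum_squares_level_step[OF l t] sq unfolding core_levels_snoc by (simp add: algebra_simps)
  }
qed

end

section \<open>The exclusion process on the ring\<close>

text \<open>With denominators cleared, this evaluates the probability that a uniform m-subset of n
  sites contains one given site and misses another.\<close>

lemma binomial_remove_two:
  assumes "1 \<le> m" "m < n"
  shows "real m * (real n - real m) * real (n choose m) =
    real n * (real n - 1) * real ((n - 2) choose (m - 1))"
proof -
  have "m = Suc (m - 1)" "n = Suc (Suc (n - 2))" "m - 1 \<le> n - 2" using assms by auto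
  then obtain l k where lk: "m = Suc l" "n = Suc (Suc k)" "l \<le> k" by blast
  have 1: "real (Suc (Suc k)) * real (Suc k choose l) = real (Suc (Suc k) choose Suc l) * real (Suc l)"
    using Suc_times_binomial_eq[of "Suc k" l] by (metis of_nat_mult)
  have 2: "real (Suc k - l) * real (Suc k choose l) = real (Suc k) * real (k choose l)"
    using binomial_absorb_comp[of "Suc k" l] by (metis diff_Suc_1 of_nat_mult)
  have "real m * (real n - real m) * real (n choose m) =
      real (Suc k - l) * (real (Suc (Suc k) choose Suc l) * real (Suc l))"
    unfolding lk using lk(3) by (simp add: of_nat_diff)
  also have "\<dots> = real (Suc (Suc k)) * (real (Suc k - l) * real (Suc k choose l))"
    unfolding 1[symmetric] by simp
  also have "\<dots> = real n * (real n - 1) * real ((n - 2) choose (m - 1))"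
    unfolding 2 lk by simp
  finally show ?thesis .
qed

context core_growth
begin

text \<open>The integrated particle current through the whole ring. Recursion on the first choice
  suits the later conditioning on that choice.\<close>

primrec current :: "nat list \<Rightarrow> int set \<Rightarrow> int" where
  "current [] = (\<lambda>Y. 0)"
| "current (t # ts) = (\<lambda>Y. of_bool (jumps (int t) Y) + current ts (ring_step (int t) Y))"

lemma sum_fold_level_step:
  assumes "set ts \<subseteq> {0..<n}" "levels a"
  shows "(\<Sum>i = k..<n. fold (\<lambda>t. level_step (int t)) ts a i) =
    (\<Sum>i = k..<n. a i) + current ts (top_residues k a)"
  using assms
proof (induction ts arbitrary: a)
  case (Cons t ts)
  then have t: "int t \<in> {0..<int n}" by simp
  show ?case
    using Cons.IH[of "level_step (int t) a"] Cons.prems levels_level_step[OF Cons.prems(2) t]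
      top_residues_level_step[OF Cons.prems(2) t, of k]
    by simp
qed simp

text \<open>A height function for the n-periodic bead set given by \<open>Y\<close>, normalised to
  vanish at 0. Counting beads above and gaps below c is impossible here, since neither needs to end;
  signed quotients produce the same slopes.\<close>

definition ring_height :: "int set \<Rightarrow> int \<Rightarrow> int" where
  "ring_height Y c = (\<Sum>r = 0..<int n. (if r \<in> Y then 1 else - 1) * ((r - c) div int n))"

lemma profile_ring_height: "profile (ring_height Y) {c. c mod int n \<in> Y}"
  unfolding profile_def
proof
  fix c
  have "ring_height Y (c + 1) = (\<Sum>r = 0..<int n. (if r \<in> Y then 1 else - 1) * ((r - c) div int n) -
      (if r = c mod int n then (if r \<in> Y then 1 else - 1) else 0))"
    unfolding ring_height_def div_Suc_diff by (intro sum.cong) (auto simp: algebra_simps)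
  also have "\<dots> = ring_height Y c - (if c mod int n \<in> Y then 1 else - 1)"
    using n_ge_2 by (simp add: sum_subtractf ring_height_def)
  finally show "ring_height Y (c + 1) = ring_height Y c + (if c \<in> {c. c mod int n \<in> Y} then - 1 else 1)"
    by simp
qed

lemma ring_step_subset:
  "t \<in> {0..<int n} \<Longrightarrow> Y \<subseteq> {0..<int n} \<Longrightarrow> ring_step t Y \<subseteq> {0..<int n}"
  unfolding ring_step_def by (cases "jumps t Y") (simp_all only: if_True if_False, blast)

lemma bead_step_periodic:
  assumes t: "t \<in> {0..<int n}" and Y: "Y \<subseteq> {0..<int n}"
  shows "bead_step t {c. c mod int n \<in> Y} = {c. c mod int n \<in> ring_step t Y}"
proof (rule set_eqI)
  fix c
  have p: "(c - 1) mod int n = (t - 1) mod int n" if "c mod int n = t" using that by (metis mod_diff_left_eq)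
  have q: "c mod int n = (t - 1) mod int n \<longleftrightarrow> (c + 1) mod int n = t" by (rule pred_mod_iff[OF t])
  have "(t - 1) mod int n \<noteq> t" by (rule pred_mod_neq[OF t])
  then show "c \<in> bead_step t {c. c mod int n \<in> Y} \<longleftrightarrow> c \<in> {c. c mod int n \<in> ring_step t Y}"
    using p q unfolding bead_step_def ring_step_def jumps_def by auto
qed

text \<open>Within one period a jump raises exactly one content, by 2. This turns the current into a
  difference of heights, to which nonexpansiveness applies.\<close>

lemma sum_fold_raise:
  assumes "set ts \<subseteq> {0..<n}" "Y \<subseteq> {0..<int n}" "profile \<phi> {c. c mod int n \<in> Y}"
  shows "(\<Sum>c = 0..<int n. fold (\<lambda>t. raise (int t)) ts \<phi> c) = (\<Sum>c = 0..<int n. \<phi> c) + 2 * current ts Y"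
  using assms
proof (induction ts arbitrary: \<phi> Y)
  case (Cons t ts)
  then have t: "int t \<in> {0..<int n}" by simp
  have "profile (raise (int t) \<phi>) {c. c mod int n \<in> ring_step (int t) Y}"
    using profile_raise[OF Cons.prems(3), of "int t"] bead_step_periodic[OF t Cons.prems(2)] by simp
  then have "(\<Sum>c = 0..<int n. fold (\<lambda>t. raise (int t)) ts (raise (int t) \<phi>) c) =
      (\<Sum>c = 0..<int n. raise (int t) \<phi> c) + 2 * current ts (ring_step (int t) Y)"
    using Cons.prems by (intro Cons.IH ring_step_subset) auto
  moreover have "(\<Sum>c = 0..<int n. raise (int t) \<phi> c) =
      (\<Sum>c = 0..<int n. \<phi> c + (if c = int t then 2 * of_bool (jumps (int t) Y) else 0))"
    unfolding raise_profile_eq[OF Cons.prems(3)]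
    by (intro sum.cong) (use t in \<open>auto simp: jumps_def\<close>)
  moreover have "\<dots> = (\<Sum>c = 0..<int n. \<phi> c) + 2 * of_bool (jumps (int t) Y)"
    using t by (simp add: sum.distrib)
  ultimately show ?case by simp
qed simp

lemma fold_raise_nonexpansive:
  assumes "\<And>c. \<bar>\<phi> c - \<psi> c\<bar> \<le> C"
  shows "\<bar>fold (\<lambda>t. raise (int t)) ts \<phi> c - fold (\<lambda>t. raise (int t)) ts \<psi> c\<bar> \<le> C"
  using assms
proof (induction ts arbitrary: \<phi> \<psi>)
  case (Cons t ts)
  show ?case using Cons.IH[OF raise_nonexpansive[OF Cons.prems, where t = "int t"]] by simp
qed simp

text \<open>All quotients (r - c) div n equal q or q + 1. The common part q drops out because equal
  cardinality makes the sums of signs equal, which leaves n terms of absolute value at most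
  2.\<close>

lemma ring_height_diff:
  assumes "Y \<subseteq> {0..<int n}" "Z \<subseteq> {0..<int n}" "card Y = card Z"
  shows "\<bar>ring_height Y c - ring_height Z c\<bar> \<le> 2 * int n"
proof -
  define q where "q = (- c) div int n"
  define s where "s X r = (if r \<in> X then 1 else - 1 :: int)" for X and r :: int
  have n0: "0 < int n" using n_ge_2 by simp
  have e: "(r - c) div int n - q \<in> {0, 1}" if r: "r \<in> {0..<int n}" for r
  proof -
    have "q \<le> (r - c) div int n" unfolding q_def using r n0 by (intro zdiv_mono1) auto
    moreover have "(r - c) div int n \<le> (- c + 1 * int n) div int n" using r n0 by (intro zdiv_mono1) auto
    moreover have "(- c + 1 * int n) div int n = q + 1"
      unfolding q_def using n0 by (subst div_mult_self1) auto
    ultimately show ?thesis by auto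
  qed
  have s: "(\<Sum>r = 0..<int n. s X r) = 2 * int (card X) - int n" if "X \<subseteq> {0..<int n}" for X
  proof -
    have "(\<Sum>r = 0..<int n. s X r) = (\<Sum>r = 0..<int n. 2 * of_bool (r \<in> X) - 1)"
      by (intro sum.cong) (auto simp: s_def)
    also have "\<dots> = 2 * (\<Sum>r = 0..<int n. of_bool (r \<in> X)) - int n"
      by (simp add: sum_subtractf sum_distrib_left)
    also have "(\<Sum>r = 0..<int n. of_bool (r \<in> X)) = int (card X)"
      using that by (simp add: of_bool_def sum.If_cases Int_absorb1 Int_absorb2)
    finally show ?thesis .
  qed
  have "ring_height Y c - ring_height Z c = (\<Sum>r = 0..<int n. (s Y r - s Z r) * ((r - c) div int n))"
    unfolding ring_height_def s_def by (simp add: sum_subtractf algebra_simps)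
  also have "\<dots> = (\<Sum>r = 0..<int n. (s Y r - s Z r) * ((r - c) div int n - q)) +
      q * ((\<Sum>r = 0..<int n. s Y r) - (\<Sum>r = 0..<int n. s Z r))"
    by (simp add: sum_subtractf sum_distrib_left sum.distrib[symmetric] algebra_simps)
  also have "\<dots> = (\<Sum>r = 0..<int n. (s Y r - s Z r) * ((r - c) div int n - q))"
    using s assms by simp
  finally have "\<bar>ring_height Y c - ring_height Z c\<bar> \<le>
      (\<Sum>r = 0..<int n. \<bar>(s Y r - s Z r) * ((r - c) div int n - q)\<bar>)"
    by (simp add: sum_abs)
  also have "\<dots> \<le> (\<Sum>r = 0..<int n. 2)"
    using e by (intro sum_mono) (force simp: s_def)
  finally show ?thesis by simp
qed

text \<open>The two runs share their choices, so their heights stay within 2 n of each other at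
  every content. Summation over a period, at the end and at the start, bounds twice the difference
  of the currents by 4 n^2.\<close>

lemma current_diff:
  assumes "set ts \<subseteq> {0..<n}" "Y \<subseteq> {0..<int n}" "Z \<subseteq> {0..<int n}" "card Y = card Z"
  shows "\<bar>current ts Y - current ts Z\<bar> \<le> 2 * (int n)\<^sup>2"
proof -
  define F where "F Y = fold (\<lambda>t. raise (int t)) ts (ring_height Y)" for Y
  note d = ring_height_diff[OF assms(2-4)]
  have "2 * (current ts Y - current ts Z) =
      (\<Sum>c = 0..<int n. F Y c - F Z c) - (\<Sum>c = 0..<int n. ring_height Y c - ring_height Z c)"
    using sum_fold_raise[OF assms(1,2) profile_ring_height] sum_fold_raise[OF assms(1,3) profile_ring_height]
    unfolding F_def by (simp add: sum_subtractf)
  moreover have "\<bar>\<Sum>c = 0..<int n. F Y c - F Z c\<bar> \<le> (\<Sum>c = 0..<int n. 2 * int n)"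
    unfolding F_def using fold_raise_nonexpansive[OF d] by (intro order_trans[OF sum_abs sum_mono])
  moreover have "\<bar>\<Sum>c = 0..<int n. ring_height Y c - ring_height Z c\<bar> \<le> (\<Sum>c = 0..<int n. 2 * int n)"
    using d by (intro order_trans[OF sum_abs sum_mono])
  ultimately show ?thesis by (simp add: power2_eq_square)
qed

section \<open>Stationarity of the uniform distribution and its jump rate\<close>

definition configs :: "nat \<Rightarrow> int set set" where
  "configs m = {Y. Y \<subseteq> {0..<int n} \<and> card Y = m}"

lemma finite_configs: "finite (configs m)"
  unfolding configs_def by (rule finite_subset[of _ "Pow {0..<int n}"]) auto

lemma card_configs: "card (configs m) = n choose m"
proof -
  have "card {Y. Y \<subseteq> {0..<int n} \<and> card Y = m} = card {0..<int n} choose m"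
    by (rule n_subsets) simp
  then show ?thesis by (simp only: configs_def card_atLeastLessThan_int nat_int diff_zero)
qed

definition exits :: "nat \<Rightarrow> int \<Rightarrow> int set set" where
  "exits m t = {Y \<in> configs m. jumps t Y}"

definition entries :: "nat \<Rightarrow> int \<Rightarrow> int set set" where
  "entries m t = {Y \<in> configs m. t \<in> Y \<and> (t - 1) mod int n \<notin> Y}"

lemma bij_betw_ring_step:
  assumes t: "t \<in> {0..<int n}"
  shows "bij_betw (ring_step t) (exits m t) (entries m t)"
proof -
  define s where "s = (t - 1) mod int n"
  have ne: "s \<noteq> t" unfolding s_def by (rule pred_mod_neq[OF t])
  have s: "s \<in> {0..<int n}" unfolding s_def using n_ge_2 by auto
  have c: "card (insert x (Y - {y})) = card Y" if "Y \<subseteq> {0..<int n}" "y \<in> Y" "x \<notin> Y" for x y Y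
  proof -
    have f: "finite Y" using that finite_subset by blast
    then have "0 < card Y" using that by (auto simp: card_gt_0_iff)
    then show ?thesis using f that by (simp add: card_insert_if)
  qed
  have ex: "Y \<in> exits m t \<longleftrightarrow> Y \<subseteq> {0..<int n} \<and> card Y = m \<and> s \<in> Y \<and> t \<notin> Y" for Y
    by (auto simp: exits_def configs_def jumps_def s_def)
  have en: "Y \<in> entries m t \<longleftrightarrow> Y \<subseteq> {0..<int n} \<and> card Y = m \<and> t \<in> Y \<and> s \<notin> Y" for Y
    by (auto simp: entries_def configs_def s_def)
  have rs: "ring_step t Y = insert t (Y - {s})" if "s \<in> Y" "t \<notin> Y" for Y
    using that by (simp add: ring_step_def jumps_def s_def)
  show ?thesis
  proof (rule bij_betw_byWitness[where f' = "\<lambda>Y. insert s (Y - {t})"])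
    show "\<forall>Y\<in>exits m t. insert s (ring_step t Y - {t}) = Y"
    proof
      fix Y assume "Y \<in> exits m t"
      then have Y: "s \<in> Y" "t \<notin> Y" by (auto simp: ex)
      show "insert s (ring_step t Y - {t}) = Y" unfolding rs[OF Y] using Y by blast
    qed
    show "\<forall>Y\<in>entries m t. ring_step t (insert s (Y - {t})) = Y"
    proof
      fix Y assume "Y \<in> entries m t"
      then have Y: "t \<in> Y" "s \<notin> Y" by (auto simp: en)
      have Z: "s \<in> insert s (Y - {t})" "t \<notin> insert s (Y - {t})" using ne by auto
      show "ring_step t (insert s (Y - {t})) = Y" unfolding rs[OF Z] using Y by blast
    qed
    show "ring_step t ` exits m t \<subseteq> entries m t"
    proof safe
      fix Y assume "Y \<in> exits m t"
      then have Y: "Y \<subseteq> {0..<int n}" "card Y = m" "s \<in> Y" "t \<notin> Y" by (auto simp: ex)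
      show "ring_step t Y \<in> entries m t"
        unfolding rs[OF Y(3,4)] en using c[OF Y(1,3,4)] Y ne t by blast
    qed
    show "(\<lambda>Y. insert s (Y - {t})) ` entries m t \<subseteq> exits m t"
    proof safe
      fix Y assume "Y \<in> entries m t"
      then have Y: "Y \<subseteq> {0..<int n}" "card Y = m" "t \<in> Y" "s \<notin> Y" by (auto simp: en)
      show "insert s (Y - {t}) \<in> exits m t"
        unfolding ex using c[OF Y(1,3,4)] Y ne s by blast
    qed
  qed
qed

lemma ring_step_configs:
  assumes "t \<in> {0..<int n}" "Y \<in> configs m"
  shows "ring_step t Y \<in> configs m"
proof (cases "jumps t Y")
  case True
  then have "Y \<in> exits m t" using assms by (simp add: exits_def)
  then have "ring_step t Y \<in> entries m t"
    using bij_betw_ring_step[OF assms(1)] by (rule bij_betw_apply[rotated])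
  then show ?thesis by (simp add: entries_def)
next
  case False
  then show ?thesis using assms(2) by (simp add: ring_step_def)
qed

text \<open>A single t need not preserve the uniform distribution: weight moves from
  \<open>exits\<close> to \<open>entries\<close>, and the net gain at \<open>Y\<close> is the
  indicator of t in \<open>Y\<close> minus that of t - 1 in \<open>Y\<close>. Over all t around the
  ring these gains cancel.\<close>

lemma sum_ring_step:
  fixes g :: "int set \<Rightarrow> real"
  shows "(\<Sum>t = 0..<int n. \<Sum>Y\<in>configs m. g (ring_step t Y)) = real n * (\<Sum>Y\<in>configs m. g Y)"
proof -
  define p where "p t = (t - 1) mod int n" for t
  have fin: "finite (exits m t)" "finite (entries m t)" "finite (configs m)" for t
    using finite_configs by (auto simp: exits_def entries_def)
  have step: "(\<Sum>Y\<in>configs m. g (ring_step t Y)) =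
      (\<Sum>Y\<in>configs m. g Y + (of_bool (t \<in> Y) - of_bool (p t \<in> Y)) * g Y)"
    if t: "t \<in> {0..<int n}" for t
  proof -
    have sub: "exits m t \<subseteq> configs m" by (auto simp: exits_def)
    have "(\<Sum>Y\<in>configs m. g (ring_step t Y)) =
        (\<Sum>Y\<in>configs m - exits m t. g (ring_step t Y)) + (\<Sum>Y\<in>exits m t. g (ring_step t Y))"
      by (rule sum.subset_diff[OF sub fin(3)])
    also have "(\<Sum>Y\<in>configs m - exits m t. g (ring_step t Y)) = (\<Sum>Y\<in>configs m - exits m t. g Y)"
      by (intro sum.cong) (auto simp: exits_def ring_step_def)
    also have "(\<Sum>Y\<in>exits m t. g (ring_step t Y)) = (\<Sum>Y\<in>entries m t. g Y)"
      by (rule sum.reindex_bij_betw[OF bij_betw_ring_step[OF t]])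
    also have "(\<Sum>Y\<in>configs m - exits m t. g Y) = (\<Sum>Y\<in>configs m. g Y) - (\<Sum>Y\<in>exits m t. g Y)"
      by (rule sum_diff[OF fin(3) sub])
    also have "(\<Sum>Y\<in>exits m t. g Y) = (\<Sum>Y\<in>configs m. of_bool (jumps t Y) * g Y)"
      unfolding exits_def using fin(3) by (simp add: sum.inter_filter of_bool_def if_distrib cong: if_cong)
        (auto intro: sum.cong)
    also have "(\<Sum>Y\<in>entries m t. g Y) = (\<Sum>Y\<in>configs m. of_bool (t \<in> Y \<and> p t \<notin> Y) * g Y)"
      unfolding entries_def p_def using fin(3) by (simp add: sum.inter_filter of_bool_def if_distrib cong: if_cong)
        (auto intro: sum.cong)
    finally have "(\<Sum>Y\<in>configs m. g (ring_step t Y)) = (\<Sum>Y\<in>configs m. g Y) -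
        (\<Sum>Y\<in>configs m. of_bool (jumps t Y) * g Y) + (\<Sum>Y\<in>configs m. of_bool (t \<in> Y \<and> p t \<notin> Y) * g Y)" .
    also have "\<dots> = (\<Sum>Y\<in>configs m. g Y - of_bool (jumps t Y) * g Y + of_bool (t \<in> Y \<and> p t \<notin> Y) * g Y)"
      by (simp add: sum.distrib sum_subtractf)
    also have "\<dots> = (\<Sum>Y\<in>configs m. g Y + (of_bool (t \<in> Y) - of_bool (p t \<in> Y)) * g Y)"
    proof (intro sum.cong refl)
      fix Y
      have "jumps t Y \<longleftrightarrow> p t \<in> Y \<and> t \<notin> Y" by (simp only: jumps_def p_def)
      then show "g Y - of_bool (jumps t Y) * g Y + of_bool (t \<in> Y \<and> p t \<notin> Y) * g Y =
          g Y + (of_bool (t \<in> Y) - of_bool (p t \<in> Y)) * g Y"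
        by (cases "t \<in> Y"; cases "p t \<in> Y") simp_all
    qed
    finally show ?thesis .
  qed
  have bij: "bij_betw p {0..<int n} {0..<int n}"
    by (rule bij_betw_byWitness[where f' = "\<lambda>t. (t + 1) mod int n"])
      (use n_ge_2 in \<open>auto simp: p_def mod_simps\<close>)
  have bal: "(\<Sum>t = 0..<int n. of_bool (t \<in> Y) - of_bool (p t \<in> Y)) = (0 :: real)" for Y
    using sum.reindex_bij_betw[OF bij, of "\<lambda>t. of_bool (t \<in> Y) :: real"] by (simp add: sum_subtractf)
  have "(\<Sum>t = 0..<int n. \<Sum>Y\<in>configs m. g (ring_step t Y)) =
      (\<Sum>t = 0..<int n. \<Sum>Y\<in>configs m. g Y + (of_bool (t \<in> Y) - of_bool (p t \<in> Y)) * g Y)"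
    by (intro sum.cong refl step)
  also have "\<dots> = (\<Sum>Y\<in>configs m. \<Sum>t = 0..<int n. g Y + (of_bool (t \<in> Y) - of_bool (p t \<in> Y)) * g Y)"
    by (rule sum.swap)
  also have "\<dots> = (\<Sum>Y\<in>configs m. real n * g Y)"
    by (intro sum.cong refl) (simp add: sum.distrib sum_distrib_right[symmetric] bal)
  finally show ?thesis by (simp add: sum_distrib_left)
qed

text \<open>One site is prescribed as occupied and one as empty, so m - 1 particles are distributed
  over n - 2 sites.\<close>

lemma card_exits:
  assumes t: "t \<in> {0..<int n}" and m: "1 \<le> m"
  shows "card (exits m t) = (n - 2) choose (m - 1)"
proof -
  define s where "s = (t - 1) mod int n"
  define X where "X = {0..<int n} - {s, t}"
  have ne: "s \<noteq> t" unfolding s_def by (rule pred_mod_neq[OF t])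
  have s: "s \<in> {0..<int n}" unfolding s_def using n_ge_2 by auto
  have X: "finite X" "s \<notin> X" "t \<notin> X" unfolding X_def by auto
  have "card X = card {0..<int n} - card {s, t}"
    unfolding X_def using s t by (intro card_Diff_subset) auto
  then have cX: "card X = n - 2" using ne by simp
  have ex: "Y \<in> exits m t \<longleftrightarrow> Y \<subseteq> {0..<int n} \<and> card Y = m \<and> s \<in> Y \<and> t \<notin> Y" for Y
    by (auto simp: exits_def configs_def jumps_def s_def)
  have "bij_betw (insert s) {Z. Z \<subseteq> X \<and> card Z = m - 1} (exits m t)"
  proof (rule bij_betw_byWitness[where f' = "\<lambda>Y. Y - {s}"])
    show "insert s ` {Z. Z \<subseteq> X \<and> card Z = m - 1} \<subseteq> exits m t"
    proof safe
      fix Z assume Z: "Z \<subseteq> X" "card Z = m - 1"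
      then have f: "finite Z" "s \<notin> Z" "t \<notin> Z" using X finite_subset by blast+
      then have "card (insert s Z) = m" using Z(2) m by simp
      moreover have "insert s Z \<subseteq> {0..<int n}" using Z(1) s unfolding X_def by blast
      ultimately show "insert s Z \<in> exits m t" unfolding ex using f ne by blast
    qed
    show "(\<lambda>Y. Y - {s}) ` exits m t \<subseteq> {Z. Z \<subseteq> X \<and> card Z = m - 1}"
    proof (rule image_subsetI)
      fix Y assume Y: "Y \<in> exits m t"
      then have "card (Y - {s}) = m - 1" "Y - {s} \<subseteq> X"
        unfolding ex X_def by (auto simp: card_Diff_singleton_if)
      then show "Y - {s} \<in> {Z. Z \<subseteq> X \<and> card Z = m - 1}" by blast
    qed
    show "\<forall>Y\<in>exits m t. insert s (Y - {s}) = Y" by (simp add: ex insert_absorb)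
    show "\<forall>Z\<in>{Z. Z \<subseteq> X \<and> card Z = m - 1}. insert s Z - {s} = Z" using X by blast
  qed
  then have "card (exits m t) = card {Z. Z \<subseteq> X \<and> card Z = m - 1}" by (rule bij_betw_same_card[symmetric])
  also have "\<dots> = (n - 2) choose (m - 1)" unfolding n_subsets[OF X(1)] cX ..
  finally show ?thesis .
qed

text \<open>The probability of a jump in one step from a uniform configuration of m
  particles.\<close>

definition rate :: "nat \<Rightarrow> real" where
  "rate m = real m * (real n - real m) / (real n * (real n - 1))"

lemma sum_jumps:
  assumes "m \<le> n"
  shows "(\<Sum>t = 0..<int n. \<Sum>Y\<in>configs m. of_bool (jumps t Y)) = real n * real (n choose m) * rate m"
proof -
  have "(\<Sum>Y\<in>configs m. of_bool (jumps t Y)) = real (card (exits m t))" for t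
    unfolding exits_def using finite_configs by (simp add: of_bool_def sum.If_cases Int_def)
  then have "(\<Sum>t = 0..<int n. \<Sum>Y\<in>configs m. of_bool (jumps t Y)) = (\<Sum>t = 0..<int n. real (card (exits m t)))"
    by simp
  also have "\<dots> = real n * real (n choose m) * rate m"
  \<comment> \<open>An empty or a full ring never jumps. These cases are split off because the
    truncated m - 1 would give a wrong count at m = 0, and \<open>binomial_remove_two\<close> asks
    for m < n.\<close>
  proof (cases "m = 0 \<or> m = n")
    case True
    have "exits m t = {}" if t: "t \<in> {0..<int n}" for t
    proof -
      have "Y = {} \<or> Y = {0..<int n}" if "Y \<in> configs m" for Y
      proof -
        have Y: "Y \<subseteq> {0..<int n}" "card Y = m" "finite Y"
          using that finite_subset by (auto simp: configs_def)
        then show ?thesis using True card_subset_eq[of "{0..<int n}" Y] by auto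
      qed
      then show ?thesis using t unfolding exits_def jumps_def by blast
    qed
    then show ?thesis using True by (auto simp: rate_def)
  next
    case False
    then have m: "1 \<le> m" "m < n" using assms by auto
    have "(\<Sum>t = 0..<int n. real (card (exits m t))) = (\<Sum>t = 0..<int n. real ((n - 2) choose (m - 1)))"
      by (intro sum.cong refl) (simp only: card_exits[OF _ m(1)])
    also have "\<dots> = real n * real ((n - 2) choose (m - 1))" by simp
    also have "real ((n - 2) choose (m - 1)) = real (n choose m) * rate m"
    proof -
      have "real n * (real n - 1) \<noteq> 0" using n_ge_2 by simp
      then show ?thesis
        using binomial_remove_two[OF m] unfolding rate_def by (simp add: field_simps)
    qed
    finally show ?thesis by simp
  qed
  finally show ?thesis .
qed

section \<open>Concentration of the levels\<close>

abbreviation choices :: "nat \<Rightarrow> nat list pmf" where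
  "choices K \<equiv> replicate_pmf K (pmf_of_set {0..<n})"

lemma nonempty_choices: "{0..<n} \<noteq> {}" "finite {0..<n}"
  using n_ge_2 by auto

lemma set_choices: "set_pmf (choices K) = {ts. set ts \<subseteq> {0..<n} \<and> length ts = K}"
  using set_pmf_of_set[OF nonempty_choices] by (auto simp: set_replicate_pmf)

lemma finite_set_choices: "finite (set_pmf (choices K))"
  unfolding set_choices by (rule finite_lists_length_eq) simp

lemma integrable_choices: "integrable (measure_pmf (choices K)) (f :: nat list \<Rightarrow> real)"
  by (rule integrable_measure_pmf_finite[OF finite_set_choices])

lemma expectation_choices_Suc:
  fixes f :: "nat list \<Rightarrow> real"
  shows "measure_pmf.expectation (choices (Suc K)) f =
    (\<Sum>t<n. measure_pmf.expectation (choices K) (\<lambda>ts. f (t # ts))) / real n"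
proof -
  have "choices (Suc K) = pmf_of_set {0..<n} \<bind> (\<lambda>t. map_pmf ((#) t) (choices K))"
    by (simp add: map_pmf_def)
  then have "measure_pmf.expectation (choices (Suc K)) f =
      (\<Sum>t\<in>{0..<n}. measure_pmf.expectation (map_pmf ((#) t) (choices K)) f /\<^sub>R real (card {0..<n}))"
    using finite_set_choices nonempty_choices by (simp only:) (rule pmf_expectation_bind_pmf_of_set, auto)
  then show ?thesis
    by (simp add: divide_inverse_commute sum_distrib_left atLeast0LessThan)
qed

lemma expectation_choices_mono:
  fixes f g :: "nat list \<Rightarrow> real"
  assumes "\<And>ts. set ts \<subseteq> {0..<n} \<Longrightarrow> f ts \<le> g ts"
  shows "measure_pmf.expectation (choices K) f \<le> measure_pmf.expectation (choices K) g"
  using assms by (intro integral_mono_AE integrable_choices) (auto simp: AE_measure_pmf_iff set_choices)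

section \<open>Mean and variance of the current\<close>

definition mean_current :: "nat \<Rightarrow> int set \<Rightarrow> real" where
  "mean_current K Y = measure_pmf.expectation (choices K) (\<lambda>ts. real_of_int (current ts Y))"

lemma mean_current_Suc:
  "mean_current (Suc K) Y =
    (\<Sum>t<n. of_bool (jumps (int t) Y) + mean_current K (ring_step (int t) Y)) / real n"
  unfolding mean_current_def expectation_choices_Suc
  by (simp add: integrable_choices)

lemma mean_current_diff:
  assumes "Y \<in> configs m" "Z \<in> configs m"
  shows "\<bar>mean_current K Y - mean_current K Z\<bar> \<le> 2 * (real n)\<^sup>2"
proof -
  have "mean_current K A \<le> mean_current K B + 2 * (real n)\<^sup>2" if AB: "A \<in> configs m" "B \<in> configs m" for A B
  proof -
    have "mean_current K A \<le> measure_pmf.expectation (choices K) (\<lambda>ts. real_of_int (current ts B) + 2 * (real n)\<^sup>2)"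
      unfolding mean_current_def
    proof (rule expectation_choices_mono)
      fix ts assume "set ts \<subseteq> {0..<n}"
      then have "\<bar>current ts A - current ts B\<bar> \<le> 2 * (int n)\<^sup>2"
        using AB by (intro current_diff) (auto simp: configs_def)
      then have "current ts A \<le> current ts B + 2 * (int n)\<^sup>2" by linarith
      then have "real_of_int (current ts A) \<le> real_of_int (current ts B + 2 * (int n)\<^sup>2)"
        by (simp only: of_int_le_iff)
      then show "real_of_int (current ts A) \<le> real_of_int (current ts B) + 2 * (real n)\<^sup>2" by simp
    qed
    then show ?thesis by (simp add: mean_current_def integrable_choices)
  qed
  from this[OF assms] this[OF assms(2,1)] show ?thesis by linarith
qed

lemma sum_nat_int_range: "(\<Sum>t<n. f (int t)) = (\<Sum>t = 0..<int n. f t)"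
  by (rule sum.reindex_bij_witness[of _ nat int]) auto

text \<open>There is no error term: up to the factor n choose m this is the mean from the uniform
  start, and by stationarity every step contributes the same amount.\<close>

lemma sum_mean_current:
  assumes "m \<le> n"
  shows "(\<Sum>Y\<in>configs m. mean_current K Y) = real K * (real (n choose m) * rate m)"
proof (induction K)
  case 0
  then show ?case by (simp add: mean_current_def)
next
  case (Suc K)
  have n0: "real n \<noteq> 0" using n_ge_2 by simp
  have "(\<Sum>Y\<in>configs m. mean_current (Suc K) Y) =
      (\<Sum>Y\<in>configs m. \<Sum>t = 0..<int n. of_bool (jumps t Y) + mean_current K (ring_step t Y)) / real n"
  proof -
    have "mean_current (Suc K) Y =
        (\<Sum>t = 0..<int n. of_bool (jumps t Y) + mean_current K (ring_step t Y)) / real n" for Y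
      using sum_nat_int_range[of "\<lambda>t. of_bool (jumps t Y) + mean_current K (ring_step t Y)"]
      by (simp add: mean_current_Suc)
    then show ?thesis by (simp add: sum_divide_distrib[symmetric])
  qed
  also have "(\<Sum>Y\<in>configs m. \<Sum>t = 0..<int n. of_bool (jumps t Y) + mean_current K (ring_step t Y)) =
      (\<Sum>t = 0..<int n. \<Sum>Y\<in>configs m. of_bool (jumps t Y) + mean_current K (ring_step t Y))"
    by (rule sum.swap)
  also have "\<dots> = real n * real (n choose m) * rate m + real n * (\<Sum>Y\<in>configs m. mean_current K Y)"
    unfolding sum.distrib sum_ring_step sum_jumps[OF assms] ..
  also have "\<dots> / real n = real (n choose m) * rate m + (\<Sum>Y\<in>configs m. mean_current K Y)"
    using n0 by (simp add: add_divide_distrib)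
  finally show ?case unfolding Suc.IH by (simp add: algebra_simps)
qed

text \<open>The average over all starts is exactly linear in K, and no start differs from another by
  more than 2 n^2.\<close>

lemma mean_current_rate:
  assumes Y: "Y \<in> configs m" and m: "m \<le> n"
  shows "\<bar>mean_current K Y - real K * rate m\<bar> \<le> 2 * (real n)\<^sup>2"
proof -
  define N where "N = real (n choose m)"
  have N: "0 < N" unfolding N_def using m by (simp add: zero_less_binomial)
  have "N * (mean_current K Y - real K * rate m) = (\<Sum>Z\<in>configs m. mean_current K Y - mean_current K Z)"
    unfolding sum_subtractf sum_mean_current[OF m] N_def by (simp add: card_configs algebra_simps)
  then have "\<bar>N * (mean_current K Y - real K * rate m)\<bar> \<le> (\<Sum>Z\<in>configs m. 2 * (real n)\<^sup>2)"
    using mean_current_diff[OF Y] by (simp only:) (intro order_trans[OF sum_abs sum_mono], auto)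
  also have "\<dots> = N * (2 * (real n)\<^sup>2)" by (simp add: card_configs N_def)
  finally show ?thesis using N by (simp add: abs_mult)
qed

text \<open>Conditioning on the first choice t splits the deviation into \<open>d t\<close>, the
  shift of the conditional mean, and \<open>c\<close>, the deviation of the remaining run. The
  latter has mean 0, so the cross term vanishes and the step adds at most the square of the bound on
  \<open>d t\<close>.\<close>

lemma variance_current:
  assumes "Y \<in> configs m"
  shows "measure_pmf.expectation (choices K) (\<lambda>ts. (real_of_int (current ts Y) - mean_current K Y)\<^sup>2)
    \<le> real K * (2 * (real n)\<^sup>2 + 1)\<^sup>2"
  using assms
proof (induction K arbitrary: Y)
  case 0
  then show ?case by (simp add: mean_current_def)
next
  case (Suc K)
  have n0: "0 < real n" using n_ge_2 by simp
  define x where "x t = of_bool (jumps (int t) Y) + mean_current K (ring_step (int t) Y)" for t :: nat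
  define d where "d t = x t - mean_current (Suc K) Y" for t
  have conf: "ring_step (int t) Y \<in> configs m" if "t < n" for t
    using ring_step_configs[OF _ Suc.prems, of "int t"] that by simp
  have x: "\<bar>x t - x s\<bar> \<le> 2 * (real n)\<^sup>2 + 1" if "t < n" "s < n" for t s
  proof -
    have "\<bar>of_bool (jumps (int t) Y) - of_bool (jumps (int s) Y)\<bar> \<le> (1 :: real)" by (simp add: of_bool_def)
    then show ?thesis
      using mean_current_diff[OF conf[OF that(1)] conf[OF that(2)], of K] unfolding x_def by linarith
  qed
  have d: "\<bar>d t\<bar> \<le> 2 * (real n)\<^sup>2 + 1" if "t < n" for t
  proof -
    \<comment> \<open>\<open>mean_current (Suc K) Y\<close> is the average of the
      \<open>x s\<close>, so \<open>d t\<close> is an average of differences. Each is at most 2 n^2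
      from the later run plus 1 from the first jump.\<close>
    have "real n * d t = (\<Sum>s<n. x t - x s)"
      using n0 unfolding d_def mean_current_Suc x_def[symmetric] by (simp add: sum_subtractf algebra_simps)
    then have "\<bar>real n * d t\<bar> \<le> (\<Sum>s<n. 2 * (real n)\<^sup>2 + 1)"
      using x[OF that] by (simp only:) (intro order_trans[OF sum_abs sum_mono], auto)
    also have "\<dots> = real n * (2 * (real n)\<^sup>2 + 1)" by simp
    finally show ?thesis using n0 by (simp add: abs_mult)
  qed
  have E: "measure_pmf.expectation (choices K)
        (\<lambda>ts. (real_of_int (current (t # ts) Y) - mean_current (Suc K) Y)\<^sup>2)
      \<le> real (Suc K) * (2 * (real n)\<^sup>2 + 1)\<^sup>2" if t: "t < n" for t
  proof -
    define Z where "Z = ring_step (int t) Y"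
    define c where "c ts = real_of_int (current ts Z) - mean_current K Z" for ts
    have "(real_of_int (current (t # ts) Y) - mean_current (Suc K) Y)\<^sup>2 = (c ts)\<^sup>2 + (2 * d t * c ts + (d t)\<^sup>2)" for ts
    proof -
      have "real_of_int (current (t # ts) Y) - mean_current (Suc K) Y = c ts + d t"
        unfolding c_def d_def x_def Z_def by simp
      then show ?thesis by (simp add: power2_eq_square algebra_simps)
    qed
    then have "measure_pmf.expectation (choices K)
        (\<lambda>ts. (real_of_int (current (t # ts) Y) - mean_current (Suc K) Y)\<^sup>2) =
        measure_pmf.expectation (choices K) (\<lambda>ts. (c ts)\<^sup>2) +
        (2 * d t * measure_pmf.expectation (choices K) c + (d t)\<^sup>2)"
      by (simp add: integrable_choices)
    moreover have "measure_pmf.expectation (choices K) c = 0"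
      unfolding c_def by (simp add: integrable_choices mean_current_def)
    moreover have "measure_pmf.expectation (choices K) (\<lambda>ts. (c ts)\<^sup>2) \<le> real K * (2 * (real n)\<^sup>2 + 1)\<^sup>2"
      unfolding c_def by (rule Suc.IH) (use conf[OF t] in \<open>simp add: Z_def\<close>)
    moreover have "(d t)\<^sup>2 \<le> (2 * (real n)\<^sup>2 + 1)\<^sup>2"
      using d[OF t] by (intro abs_le_square_iff[THEN iffD1]) simp
    ultimately show ?thesis by (simp add: algebra_simps)
  qed
  have "(\<Sum>t<n. measure_pmf.expectation (choices K)
        (\<lambda>ts. (real_of_int (current (t # ts) Y) - mean_current (Suc K) Y)\<^sup>2))
      \<le> (\<Sum>t<n. real (Suc K) * (2 * (real n)\<^sup>2 + 1)\<^sup>2)"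
    using E by (intro sum_mono) auto
  also have "\<dots> = real n * (real (Suc K) * (2 * (real n)\<^sup>2 + 1)\<^sup>2)" by simp
  finally show ?case unfolding expectation_choices_Suc using n0 by (simp add: field_simps)
qed

lemma sum_core_levels:
  assumes "set ts \<subseteq> {0..<n}"
  shows "(\<Sum>i = k..<n. core_levels ts i) = (\<Sum>i = k..<n. int i) + current ts (top_residues k int)"
  unfolding core_levels_def by (rule sum_fold_level_step[OF assms levels_int])

lemma top_residues_int: "k \<le> n \<Longrightarrow> top_residues k int \<in> configs (n - k)"
proof -
  assume k: "k \<le> n"
  have "top_residues k int = int ` {k..<n}" unfolding top_residues_def by (intro image_cong) auto
  then show ?thesis using k by (auto simp: configs_def card_image)
qed

text \<open>Chebyshev's inequality. The starting sum and the distance of the mean from its linear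
  value are bounded by \<open>C\<close> together; for large K they use up at most half of the
  tolerance, which leaves the other half for the random deviation.\<close>

lemma top_sum_concentration:
  assumes k: "k \<le> n" and \<eta>: "0 < \<eta>"
  shows "(\<lambda>K. measure_pmf.prob (choices K)
    {ts. \<eta> * real K \<le> \<bar>real_of_int (\<Sum>i = k..<n. core_levels ts i) - real K * rate (n - k)\<bar>}) \<longlonglongrightarrow> 0"
    (is "?p \<longlonglongrightarrow> 0")
proof -
  define Y where "Y = top_residues k int"
  define B where "B = 2 * (real n)\<^sup>2 + 1"
  define S0 where "S0 = real_of_int (\<Sum>i = k..<n. int i)"
  define C where "C = 2 * (real n)\<^sup>2 + S0"
  have Y: "Y \<in> configs (n - k)" unfolding Y_def by (rule top_residues_int[OF k])
  have bound: "?p K \<le> 4 * B\<^sup>2 / \<eta>\<^sup>2 * inverse (real K)" if K: "0 < K" "2 * C \<le> \<eta> * real K" for K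
  proof -
    let ?f = "\<lambda>ts. real_of_int (current ts Y) - mean_current K Y"
    have "?p K \<le> measure_pmf.prob (choices K) {ts \<in> space (measure_pmf (choices K)). \<eta> * real K / 2 \<le> \<bar>?f ts\<bar>}"
    proof (rule measure_pmf.finite_measure_mono_AE)
      show "AE ts in measure_pmf (choices K).
          ts \<in> {ts. \<eta> * real K \<le> \<bar>real_of_int (\<Sum>i = k..<n. core_levels ts i) - real K * rate (n - k)\<bar>} \<longrightarrow>
          ts \<in> {ts \<in> space (measure_pmf (choices K)). \<eta> * real K / 2 \<le> \<bar>?f ts\<bar>}"
        unfolding AE_measure_pmf_iff set_choices
      proof safe
        fix ts assume ts: "set ts \<subseteq> {0..<n}" and K': "K = length ts"
          and l: "\<eta> * real (length ts) \<le>
            \<bar>real_of_int (\<Sum>i = k..<n. core_levels ts i) - real (length ts) * rate (n - k)\<bar>"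
        have s: "real_of_int (\<Sum>i = k..<n. core_levels ts i) =
            S0 + real_of_int (current ts Y)"
          unfolding sum_core_levels[OF ts] Y_def S0_def by (rule of_int_add)
        have p: "0 \<le> S0" unfolding S0_def by (simp add: sum_nonneg)
        have "\<bar>mean_current K Y - real K * rate (n - k)\<bar> \<le> 2 * (real n)\<^sup>2"
          using mean_current_rate[OF Y] by simp
        moreover have "\<eta> * real K \<le> \<bar>S0 + real_of_int (current ts Y) - real K * rate (n - k)\<bar>"
          using l unfolding K'[symmetric] s .
        moreover have "2 * (2 * (real n)\<^sup>2) + 2 * S0 \<le> \<eta> * real K"
          using K(2) unfolding C_def by (simp only: distrib_left)
        ultimately show "\<eta> * real (length ts) / 2 \<le> \<bar>real_of_int (current ts Y) - mean_current (length ts) Y\<bar>"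
          using p unfolding K'[symmetric] by linarith
      qed auto
    qed simp
    also have "\<dots> \<le> measure_pmf.expectation (choices K) (\<lambda>ts. (?f ts)\<^sup>2) / (\<eta> * real K / 2)\<^sup>2"
      using K \<eta> by (intro measure_pmf.second_moment_method integrable_choices) auto
    also have "\<dots> \<le> real K * B\<^sup>2 / (\<eta> * real K / 2)\<^sup>2"
      using variance_current[OF Y, of K] unfolding B_def by (intro divide_right_mono) auto
    also have "\<dots> = 4 * B\<^sup>2 / \<eta>\<^sup>2 * inverse (real K)"
      using K \<eta> by (simp add: field_simps power2_eq_square)
    finally show ?thesis .
  qed
  have "(\<lambda>K. 4 * B\<^sup>2 / \<eta>\<^sup>2 * inverse (real K)) \<longlonglongrightarrow> 4 * B\<^sup>2 / \<eta>\<^sup>2 * 0"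
    by (intro tendsto_intros lim_inverse_n)
  moreover have "\<forall>\<^sub>F K in sequentially. 2 * C \<le> \<eta> * real K"
  proof -
    have "filterlim (\<lambda>K. \<eta> * real K) at_top sequentially"
      using \<eta> by (intro filterlim_tendsto_pos_mult_at_top[OF tendsto_const] filterlim_real_sequentially)
    then show ?thesis by (simp add: filterlim_at_top)
  qed
  then have "\<forall>\<^sub>F K in sequentially. ?p K \<le> 4 * B\<^sup>2 / \<eta>\<^sup>2 * inverse (real K)"
    using eventually_gt_at_top[of 0] by eventually_elim (rule bound)
  ultimately show ?thesis
    by (intro tendsto_sandwich[of "\<lambda>_. 0" ?p]) (auto simp: tendsto_const)
qed

definition speed :: "nat \<Rightarrow> real" where
  "speed i = (2 * real i + 1 - real n) / (real n * (real n - 1))"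

lemma rate_diff: "i < n \<Longrightarrow> rate (n - i) - rate (n - Suc i) = speed i"
  unfolding rate_def speed_def using n_ge_2
  by (simp add: of_nat_diff diff_divide_distrib[symmetric]) (simp add: algebra_simps)

text \<open>If one level is off, one of the two adjacent top sums is off by at least half as much.
  The union includes k = n, the empty sum, to cover the largest level.\<close>

lemma levels_concentration:
  assumes \<eta>: "0 < \<eta>"
  shows "(\<lambda>K. measure_pmf.prob (choices K)
    {ts. \<exists>i<n. \<eta> * real K < \<bar>real_of_int (core_levels ts i) - real K * speed i\<bar>}) \<longlonglongrightarrow> 0"
    (is "?p \<longlonglongrightarrow> 0")
proof -
  define A where "A K k = {ts. \<eta> / 2 * real K \<le>
    \<bar>real_of_int (\<Sum>i = k..<n. core_levels ts i) - real K * rate (n - k)\<bar>}" for K k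
  have "?p K \<le> (\<Sum>k\<le>n. measure_pmf.prob (choices K) (A K k))" for K
  proof -
    have "ts \<in> (\<Union>k\<in>{..n}. A K k)" if i: "i < n"
      and d: "\<eta> * real K < \<bar>real_of_int (core_levels ts i) - real K * speed i\<bar>" for ts i
    proof -
      define S where "S k = real_of_int (\<Sum>i = k..<n. core_levels ts i) - real K * rate (n - k)" for k
      have "(\<Sum>i = i..<n. core_levels ts i) = core_levels ts i + (\<Sum>i = Suc i..<n. core_levels ts i)"
        using i by (rule sum.atLeast_Suc_lessThan)
      then have "real_of_int (core_levels ts i) - real K * speed i = S i - S (Suc i)"
        unfolding S_def rate_diff[OF i, symmetric] by (simp add: algebra_simps)
      then have "\<eta> / 2 * real K \<le> \<bar>S i\<bar> \<or> \<eta> / 2 * real K \<le> \<bar>S (Suc i)\<bar>" using d by auto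
      then have "ts \<in> A K i \<or> ts \<in> A K (Suc i)" unfolding A_def S_def by blast
      then show ?thesis using i by (auto simp: Suc_le_eq)
    qed
    then have "?p K \<le> measure_pmf.prob (choices K) (\<Union>k\<in>{..n}. A K k)"
      by (intro measure_pmf.finite_measure_mono) auto
    also have "\<dots> \<le> (\<Sum>k\<le>n. measure_pmf.prob (choices K) (A K k))"
      by (intro measure_pmf.finite_measure_subadditive_finite) auto
    finally show ?thesis .
  qed
  moreover have "(\<lambda>K. \<Sum>k\<le>n. measure_pmf.prob (choices K) (A K k)) \<longlonglongrightarrow> (\<Sum>k\<le>n. 0)"
    using top_sum_concentration[of _ "\<eta> / 2"] \<eta> unfolding A_def by (intro tendsto_sum) auto
  ultimately show ?thesis
    by (intro tendsto_sandwich[of "\<lambda>_. 0" ?p]) (auto simp: tendsto_const)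
qed

text \<open>\<open>replicate_pmf\<close> recurses on the first entry, whereas
  \<open>random_core\<close> applies the newest choice last; hence the split of K + 1 into K and
  1.\<close>

lemma random_core_eq_map_choices:
  "random_core n K = map_pmf (\<lambda>ts. fold (growth_step n) ts {}) (choices K)"
proof (induction K)
  case (Suc K)
  have "choices (Suc K) = choices (K + 1)" by simp
  also have "\<dots> = do {ts \<leftarrow> choices K; us \<leftarrow> choices 1; return_pmf (ts @ us)}"
    by (rule replicate_pmf_distrib)
  finally show ?case unfolding random_core.simps Suc.IH replicate_pmf_1
    by (simp add: map_pmf_def bind_assoc_pmf bind_return_pmf)
qed simp

end

section \<open>The limit curve\<close>

lemma real_choose_two: "real (k choose 2) = real k * (real k - 1) / 2"
  by (induction k) (simp_all add: numeral_2_eq_2 field_simps)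

lemma sum_lessThan_real: "(\<Sum>i<m. real i) = real m * (real m - 1) / 2"
  by (induction m) (simp_all add: field_simps)

lemma sum_abs_diff_lessThan:
  assumes "j < n"
  shows "(\<Sum>i<n. \<bar>2 * real i - 2 * real j\<bar>) = real j * (real j + 1) + (real n - 1 - real j) * (real n - real j)"
proof -
  have "(\<Sum>i<Suc j + m. \<bar>2 * real i - 2 * real j\<bar>) = real j * (real j + 1) + real m * (real m + 1)" for m
  proof (induction m)
    case 0
    have "(\<Sum>i<Suc j. \<bar>2 * real i - 2 * real j\<bar>) = (\<Sum>i<Suc j. 2 * real j - 2 * real i)"
      by (intro sum.cong) auto
    also have "\<dots> = 2 * real (Suc j) * real j - 2 * (\<Sum>i<Suc j. real i)"
      by (simp only: sum_subtractf sum_distrib_left[symmetric] sum_constant card_lessThan mult.assoc mult.left_commute)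
    finally show ?case unfolding sum_lessThan_real by (simp add: field_simps)
  next
    case (Suc m)
    then show ?case by (simp add: field_simps)
  qed
  from this[of "n - Suc j"] show ?thesis using assms by (simp add: of_nat_diff algebra_simps)
qed

lemma sum_odd_squares:
  "(\<Sum>i<m. (2 * real i + 1 - c)\<^sup>2) = real m * (4 * (real m)\<^sup>2 - 1) / 3 - 2 * c * (real m)\<^sup>2 + c\<^sup>2 * real m"
  by (induction m) (simp_all add: power2_eq_square field_simps)

text \<open>Explicit estimates are avoided by contradiction: if no \<open>\<eta>\<close> worked, the
  values 1 / (m + 1) would give counterexamples with K > m, and along them continuity drives the
  expression to 0. In the application q is the sum of the squares of the initial levels and C the
  error constant of the boundary curve.\<close>

lemma scaled_levels_limit:
  fixes v :: "nat \<Rightarrow> real"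
  assumes n: "0 < n" and \<alpha>: "\<alpha> = (\<Sum>i<n. (v i)\<^sup>2) / (2 * real n)" "0 < \<alpha>" and \<delta>: "0 < \<delta>"
  shows "\<exists>\<eta>>0. \<exists>L. \<forall>K\<ge>L. \<forall>x s. (\<forall>i<n. \<bar>x i - real K * v i\<bar> \<le> \<eta> * real K) \<longrightarrow>
    s = sqrt (((\<Sum>i<n. (x i)\<^sup>2) - q) / (2 * real n)) \<longrightarrow>
    0 < s \<and> C / s + (\<Sum>i<n. \<bar>x i / s - v i / sqrt \<alpha>\<bar>) / real n \<le> \<delta>"
    (is "\<exists>\<eta>>0. \<exists>L. \<forall>K\<ge>L. ?P \<eta> K")
proof (rule ccontr)
  assume neg: "\<not> ?thesis"
  define P where "P m K x s \<longleftrightarrow> m < K \<and> (\<forall>i<n. \<bar>x i - real K * v i\<bar> \<le> inverse (real (Suc m)) * real K) \<and>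
      s = sqrt (((\<Sum>i<n. (x i)\<^sup>2) - q) / (2 * real n)) \<and>
      \<not> (0 < s \<and> C / s + (\<Sum>i<n. \<bar>x i / s - v i / sqrt \<alpha>\<bar>) / real n \<le> \<delta>)" for m K x s
  have "\<exists>K x s. P m K x s" for m
  proof -
    have "0 < inverse (real (Suc m))" by simp
    then have "\<not> (\<forall>K\<ge>Suc m. ?P (inverse (real (Suc m))) K)" using neg by blast
    then show ?thesis unfolding P_def Suc_le_eq by blast
  qed
  then obtain K x s where P: "\<And>m. P m (K m) (x m) (s m)" by metis
  then have K: "\<And>m. m < K m"
    and x: "\<And>m i. i < n \<Longrightarrow> \<bar>x m i - real (K m) * v i\<bar> \<le> inverse (real (Suc m)) * real (K m)"
    and s: "\<And>m. s m = sqrt (((\<Sum>i<n. (x m i)\<^sup>2) - q) / (2 * real n))"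
    and bad: "\<And>m. \<not> (0 < s m \<and> C / s m + (\<Sum>i<n. \<bar>x m i / s m - v i / sqrt \<alpha>\<bar>) / real n \<le> \<delta>)"
    unfolding P_def by blast+
  have K0: "0 < real (K m)" for m using K[of m] by simp
  have Kinv: "(\<lambda>m. inverse (real (K m))) \<longlonglongrightarrow> 0"
  proof (rule tendsto_sandwich[of "\<lambda>_. 0" _ _ "\<lambda>m. inverse (real (Suc m))"])
    have "real (Suc m) \<le> real (K m)" for m using K[of m] by simp
    then show "\<forall>\<^sub>F m in sequentially. inverse (real (K m)) \<le> inverse (real (Suc m))"
      by (intro always_eventually allI le_imp_inverse_le) simp_all
    show "(\<lambda>m. inverse (real (Suc m))) \<longlonglongrightarrow> 0" by (rule LIMSEQ_inverse_real_of_nat)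
  qed simp_all
  have y: "(\<lambda>m. x m i / real (K m)) \<longlonglongrightarrow> v i" if i: "i < n" for i
  proof -
    have "\<bar>x m i / real (K m) - v i\<bar> \<le> inverse (real (Suc m))" for m
    proof -
      have "x m i / real (K m) - v i = (x m i - real (K m) * v i) / real (K m)"
        using K0[of m] by (simp add: field_simps)
      then show ?thesis using x[OF i, of m] K0[of m] by (simp add: abs_divide pos_divide_le_eq)
    qed
    then have "(\<lambda>m. x m i / real (K m) - v i) \<longlonglongrightarrow> 0"
      by (intro Lim_null_comparison[OF _ LIMSEQ_inverse_real_of_nat]) simp
    then show ?thesis by (simp add: LIM_zero_iff)
  qed
  have "s m / real (K m) = sqrt (((\<Sum>i<n. (x m i / real (K m))\<^sup>2) - q * (inverse (real (K m)))\<^sup>2) / (2 * real n))" for m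
  proof -
    have "real (K m) = sqrt ((real (K m))\<^sup>2)" using K0[of m] by simp
    then have "s m / real (K m) = sqrt (((\<Sum>i<n. (x m i)\<^sup>2) - q) / (2 * real n) / (real (K m))\<^sup>2)"
      unfolding s by (metis real_sqrt_divide)
    also have "((\<Sum>i<n. (x m i)\<^sup>2) - q) / (2 * real n) / (real (K m))\<^sup>2 =
        ((\<Sum>i<n. (x m i / real (K m))\<^sup>2) - q * (inverse (real (K m)))\<^sup>2) / (2 * real n)"
    proof -
      have "(\<Sum>i<n. (x m i / real (K m))\<^sup>2) = (\<Sum>i<n. (x m i)\<^sup>2) / (real (K m))\<^sup>2"
        by (simp only: power_divide sum_divide_distrib)
      moreover have "q * (inverse (real (K m)))\<^sup>2 = q / (real (K m))\<^sup>2"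
        by (simp only: power_inverse divide_inverse)
      ultimately show ?thesis by (simp only: diff_divide_distrib[symmetric] divide_divide_eq_left mult.commute)
    qed
    finally show ?thesis .
  qed
  moreover have "(\<lambda>m. sqrt (((\<Sum>i<n. (x m i / real (K m))\<^sup>2) - q * (inverse (real (K m)))\<^sup>2) / (2 * real n)))
      \<longlonglongrightarrow> sqrt (((\<Sum>i<n. (v i)\<^sup>2) - q * 0\<^sup>2) / (2 * real n))"
    using n by (intro tendsto_intros y Kinv) auto
  ultimately have lim_s: "(\<lambda>m. s m / real (K m)) \<longlonglongrightarrow> sqrt \<alpha>" by (simp add: \<alpha>(1))
  have sa: "0 < sqrt \<alpha>" using \<alpha>(2) by simp
  have lim: "(\<lambda>m. C * inverse (real (K m)) / (s m / real (K m)) +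
      (\<Sum>i<n. \<bar>(x m i / real (K m)) / (s m / real (K m)) - v i / sqrt \<alpha>\<bar>) / real n) \<longlonglongrightarrow>
      C * 0 / sqrt \<alpha> + (\<Sum>i<n. \<bar>v i / sqrt \<alpha> - v i / sqrt \<alpha>\<bar>) / real n"
    using sa n by (intro tendsto_intros y Kinv lim_s) auto
  have e1: "C * inverse (real (K m)) / (s m / real (K m)) = C / s m" for m
    using K0[of m] by (simp add: field_simps)
  have e2: "(x m i / real (K m)) / (s m / real (K m)) = x m i / s m" for m i
    using K0[of m] by simp
  have "(\<lambda>m. C / s m + (\<Sum>i<n. \<bar>x m i / s m - v i / sqrt \<alpha>\<bar>) / real n) \<longlonglongrightarrow> 0"
    using lim unfolding e1 e2 by simp
  then have "\<forall>\<^sub>F m in sequentially. C / s m + (\<Sum>i<n. \<bar>x m i / s m - v i / sqrt \<alpha>\<bar>) / real n < \<delta>"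
    using \<delta> by (rule order_tendstoD)
  moreover have "\<forall>\<^sub>F m in sequentially. 0 < s m / real (K m)"
    using lim_s sa by (rule order_tendstoD)
  ultimately have "\<forall>\<^sub>F m in sequentially. False"
  proof eventually_elim
    case (elim m)
    then show ?case using bad[of m] K0[of m] by (simp add: zero_less_divide_iff)
  qed
  then show False by simp
qed

context core_growth
begin

section \<open>The limit curve as a graph over x - y\<close>

definition scale :: real where
  "scale = sqrt 6 / sqrt ((real n)\<^sup>2 - 1)"

text \<open>The value of x - y at a vertex and, by \<open>speed_eq_limit_level\<close>, the speed
  rescaled to unit area.\<close>

definition limit_level :: "nat \<Rightarrow> real" where
  "limit_level i = (2 * real i + 1 - real n) * scale"

text \<open>On the continued limit curve this is x + y as a function of u = x - y: convex and
  piecewise linear, with its kinks at the vertices.\<close>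

definition limit_height :: "real \<Rightarrow> real" where
  "limit_height u = (\<Sum>i<n. \<bar>limit_level i - u\<bar>) / real n"

lemma scale_pos: "0 < scale"
proof -
  have "1 < (real n)\<^sup>2" using n_ge_2 by (simp add: one_less_power)
  then show ?thesis by (simp add: scale_def)
qed

lemma gamma_const_eq: "gamma_const n = 2 * scale / real n"
  by (simp add: gamma_const_def scale_def)

lemma limit_height_level:
  assumes "j < n"
  shows "limit_height (limit_level j) =
    scale * (real j * (real j + 1) + (real n - 1 - real j) * (real n - real j)) / real n"
proof -
  have "(\<Sum>i<n. \<bar>limit_level i - limit_level j\<bar>) = (\<Sum>i<n. scale * \<bar>2 * real i - 2 * real j\<bar>)"
  proof (intro sum.cong refl)
    fix i
    have "limit_level i - limit_level j = scale * (2 * real i - 2 * real j)"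
      by (simp add: limit_level_def algebra_simps)
    then show "\<bar>limit_level i - limit_level j\<bar> = scale * \<bar>2 * real i - 2 * real j\<bar>"
      using scale_pos by (simp add: abs_mult)
  qed
  then show ?thesis
    unfolding limit_height_def sum_distrib_left[symmetric] sum_abs_diff_lessThan[OF assms] by simp
qed

lemma vertex_coordinates:
  assumes "j < n"
  shows "fst (vertex n (Suc j)) - snd (vertex n (Suc j)) = limit_level j"
    and "fst (vertex n (Suc j)) + snd (vertex n (Suc j)) = limit_height (limit_level j)"
    and "0 \<le> fst (vertex n (Suc j))" and "0 \<le> snd (vertex n (Suc j))"
proof -
  have n0: "real n \<noteq> 0" using n_ge_2 by simp
  have f: "fst (vertex n (Suc j)) = scale * (real j * (real j + 1)) / real n"
    unfolding vertex_def gamma_const_eq fst_scaleR fst_conv real_choose_two using n0 by (simp add: field_simps)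
  have "real (n - Suc j + 1) = real n - real j" using assms by (simp add: of_nat_diff)
  then have s: "snd (vertex n (Suc j)) = scale * ((real n - 1 - real j) * (real n - real j)) / real n"
    unfolding vertex_def gamma_const_eq snd_scaleR snd_conv real_choose_two using n0 by (simp add: field_simps)
  show "fst (vertex n (Suc j)) - snd (vertex n (Suc j)) = limit_level j"
    unfolding f s limit_level_def using n0 by (simp add: field_simps)
  show "fst (vertex n (Suc j)) + snd (vertex n (Suc j)) = limit_height (limit_level j)"
    unfolding f s limit_height_level[OF assms] using n0 by (simp add: field_simps)
  show "0 \<le> fst (vertex n (Suc j))" unfolding f using scale_pos by simp
  show "0 \<le> snd (vertex n (Suc j))" unfolding s using scale_pos assms by simp
qed

lemma limit_height_lipschitz: "limit_height u \<le> limit_height w + \<bar>u - w\<bar>"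
proof -
  have "(\<Sum>i<n. \<bar>limit_level i - u\<bar>) \<le> (\<Sum>i<n. \<bar>limit_level i - w\<bar> + \<bar>u - w\<bar>)"
    by (intro sum_mono) linarith
  then show ?thesis using n_ge_2 by (simp add: limit_height_def sum.distrib field_simps)
qed

text \<open>The limit levels are symmetric about 0 and therefore sum to 0; the triangle inequality
  does the rest.\<close>

lemma limit_height_ge_abs: "\<bar>u\<bar> \<le> limit_height u"
proof -
  have "(\<Sum>i<n. limit_level i) = (\<Sum>i<n. 2 * real i + (1 - real n)) * scale"
    unfolding limit_level_def sum_distrib_right by (simp add: algebra_simps)
  also have "(\<Sum>i<n. 2 * real i + (1 - real n)) = 0"
    unfolding sum.distrib sum_distrib_left[symmetric] sum_lessThan_real by (simp add: field_simps)
  finally have "(\<Sum>i<n. limit_level i - u) = - real n * u" by (simp add: sum_subtractf)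
  then have "real n * \<bar>u\<bar> \<le> (\<Sum>i<n. \<bar>limit_level i - u\<bar>)"
    using sum_abs[of "\<lambda>i. limit_level i - u" "{..<n}"] by (simp add: abs_mult)
  then show ?thesis using n_ge_2 by (simp add: limit_height_def field_simps)
qed

lemma limit_level_mono: "i \<le> j \<Longrightarrow> limit_level i \<le> limit_level j"
  using scale_pos by (simp add: limit_level_def)

text \<open>Between two consecutive levels no absolute value changes its sign, so every summand is
  affine there.\<close>

lemma limit_height_segment:
  assumes "0 \<le> t" "t \<le> 1"
  shows "limit_height ((1 - t) * limit_level j + t * limit_level (Suc j)) =
    (1 - t) * limit_height (limit_level j) + t * limit_height (limit_level (Suc j))"
proof -
  have "\<bar>limit_level i - ((1 - t) * limit_level j + t * limit_level (Suc j))\<bar> =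
      (1 - t) * \<bar>limit_level i - limit_level j\<bar> + t * \<bar>limit_level i - limit_level (Suc j)\<bar>" for i
  proof -
    define p where "p = limit_level i - limit_level j"
    define q where "q = limit_level i - limit_level (Suc j)"
    have e: "limit_level i - ((1 - t) * limit_level j + t * limit_level (Suc j)) = (1 - t) * p + t * q"
      by (simp add: p_def q_def algebra_simps)
    consider "p \<le> 0" "q \<le> 0" | "0 \<le> p" "0 \<le> q"
      using limit_level_mono[of i j] limit_level_mono[of i "Suc j"] limit_level_mono[of "Suc j" i]
        limit_level_mono[of j i] unfolding p_def q_def by (cases "i \<le> j") auto
    then show ?thesis
    proof cases
      case 1
      then have "(1 - t) * p \<le> 0" "t * q \<le> 0" using assms by (auto simp: mult_nonneg_nonpos)
      then show ?thesis unfolding e p_def[symmetric] q_def[symmetric] using 1 by (simp add: abs_of_nonpos)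
    next
      case 2
      then have "0 \<le> (1 - t) * p" "0 \<le> t * q" using assms by auto
      then show ?thesis unfolding e p_def[symmetric] q_def[symmetric] using 2 by simp
    qed
  qed
  then show ?thesis
    by (simp add: limit_height_def sum.distrib sum_distrib_left[symmetric] add_divide_distrib)
qed

lemma limit_curve_eq:
  "limit_curve n = (\<Union>j<n - 1. \<Union>t\<in>{0..1}. {(1 - t) *\<^sub>R vertex n (Suc j) + t *\<^sub>R vertex n (Suc (Suc j))})"
proof -
  have "{1..<n} = Suc ` {..<n - 1}" using n_ge_2
    unfolding image_Suc_lessThan by auto
  moreover have "closed_segment a b = (\<Union>t\<in>{0..1}. {(1 - t) *\<^sub>R a + t *\<^sub>R b})" for a b :: "real \<times> real"
    by (auto simp: closed_segment_def)
  ultimately show ?thesis unfolding limit_curve_def by simp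
qed

lemma limit_curveI:
  "j < n - 1 \<Longrightarrow> 0 \<le> t \<Longrightarrow> t \<le> 1 \<Longrightarrow>
    (1 - t) *\<^sub>R vertex n (Suc j) + t *\<^sub>R vertex n (Suc (Suc j)) \<in> limit_curve n"
  unfolding limit_curve_eq by (intro UN_I[of j] UN_I[of t]) auto

lemma limit_curveD:
  assumes "(x, y) \<in> limit_curve n"
  shows "x + y = limit_height (x - y)" "0 \<le> x" "0 \<le> y"
proof -
  obtain j t where j: "j < n - 1" and t: "0 \<le> t" "t \<le> 1"
    and p: "(x, y) = (1 - t) *\<^sub>R vertex n (Suc j) + t *\<^sub>R vertex n (Suc (Suc j))"
    using assms unfolding limit_curve_eq by auto
  have jn: "j < n" "Suc j < n" using j by auto
  note v = vertex_coordinates[OF jn(1)] and w = vertex_coordinates[OF jn(2)]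
  have x: "x = (1 - t) * fst (vertex n (Suc j)) + t * fst (vertex n (Suc (Suc j)))"
    using arg_cong[OF p, of fst] by simp
  have y: "y = (1 - t) * snd (vertex n (Suc j)) + t * snd (vertex n (Suc (Suc j)))"
    using arg_cong[OF p, of snd] by simp
  have "x - y = (1 - t) * limit_level j + t * limit_level (Suc j)"
    unfolding x y v(1)[symmetric] w(1)[symmetric] by (simp add: algebra_simps)
  moreover have "x + y = (1 - t) * limit_height (limit_level j) + t * limit_height (limit_level (Suc j))"
    unfolding x y v(2)[symmetric] w(2)[symmetric] by (simp add: algebra_simps)
  ultimately show "x + y = limit_height (x - y)" using limit_height_segment[OF t] by simp
  show "0 \<le> x" "0 \<le> y" unfolding x y using t v w by auto
qed

text \<open>Beyond an end point on an axis, \<open>limit_height u\<close> must be the absolute value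
  of u: it is never smaller, and being 1-Lipschitz it cannot grow faster from the end point
  on.\<close>

lemma continued_limit_curveD:
  assumes "(x, y) \<in> continued (limit_curve n)"
  shows "x + y = limit_height (x - y)"
proof -
  consider "(x, y) \<in> limit_curve n" | a where "y = 0" "a \<le> x" "(a, 0) \<in> limit_curve n"
    | b where "x = 0" "b \<le> y" "(0, b) \<in> limit_curve n"
    using assms unfolding continued_iff by blast
  then show ?thesis
  proof cases
    case 1
    then show ?thesis by (rule limit_curveD)
  next
    case 2
    then show ?thesis
      using limit_curveD[OF 2(3)] limit_height_lipschitz[of x a] limit_height_ge_abs[of x] by auto
  next
    case 3
    then show ?thesis
      using limit_curveD[OF 3(3)] limit_height_lipschitz[of "- y" "- b"] limit_height_ge_abs[of "- y"] by auto
  qed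
qed

lemma continued_limit_curve_meets_diagonal: "\<exists>p. p \<in> continued (limit_curve n) \<inter> diagonal c"
proof -
  \<comment> \<open>The real index at which the affine formula for \<open>limit_level\<close> takes
    the value - c. Its position relative to 0 and n - 1 decides between the two axes and the
    segments.\<close>
  define z where "z = (- c / scale + real n - 1) / 2"
  have "2 * z = - c / scale + real n - 1" unfolding z_def by simp
  then have "2 * z + 1 - real n = - c / scale" by simp
  then have c: "- c = (2 * z + 1 - real n) * scale" using scale_pos by simp
  have vm: "vertex n (Suc j) \<in> limit_curve n" if "j < n" for j
  proof (cases "j < n - 1")
    case True
    then show ?thesis using limit_curveI[of j 0] by simp
  next
    case False
    then have "Suc (n - 2) = j" "n - 2 < n - 1" using that n_ge_2 by auto
    then show ?thesis using limit_curveI[of "n - 2" 1] by simp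
  qed
  consider "z < 0" | "real n - 1 < z" | "0 \<le> z" "z \<le> real n - 1" by linarith
  then show ?thesis
  proof cases
    case 1
    have v: "vertex n (Suc 0) = (0, limit_level 0 * (- 1))"
    proof -
      have "fst (vertex n (Suc 0)) = 0" by (simp add: vertex_def binomial_eq_0)
      then show ?thesis using vertex_coordinates(1)[of 0] n_ge_2 by (simp add: prod_eq_iff)
    qed
    have "limit_level 0 * (- 1) \<le> c"
    proof -
      have "(2 * z + 1 - real n) * scale \<le> (1 - real n) * scale"
        using 1 scale_pos by (intro mult_right_mono) auto
      then show ?thesis using c by (simp add: limit_level_def)
    qed
    then have "(0, c) \<in> continued (limit_curve n)"
      using vm[of 0] n_ge_2 unfolding continued_iff v by auto
    moreover have "(0, c) \<in> diagonal c" by (simp add: diagonal_def)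
    ultimately show ?thesis by blast
  next
    case 2
    have v: "vertex n (Suc (n - 1)) = (limit_level (n - 1), 0)"
    proof -
      have "snd (vertex n (Suc (n - 1))) = 0" using n_ge_2 by (simp add: vertex_def binomial_eq_0)
      then show ?thesis using vertex_coordinates(1)[of "n - 1"] n_ge_2 by (simp add: prod_eq_iff)
    qed
    have "limit_level (n - 1) \<le> - c"
    proof -
      have "(real n - 1) * scale \<le> (2 * z + 1 - real n) * scale"
        using 2 scale_pos by (intro mult_right_mono) auto
      moreover have "2 * real (n - 1) + 1 - real n = real n - 1" using n_ge_2 by (simp add: of_nat_diff)
      ultimately show ?thesis using c by (simp add: limit_level_def)
    qed
    then have "(- c, 0) \<in> continued (limit_curve n)"
      using vm[of "n - 1"] n_ge_2 unfolding continued_iff v by auto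
    moreover have "(- c, 0) \<in> diagonal c" by (simp add: diagonal_def)
    ultimately show ?thesis by blast
  next
    case 3
    \<comment> \<open>The cap at n - 2 puts z = n - 1 on the last segment, with t = 1.\<close>
    define j where "j = min (nat \<lfloor>z\<rfloor>) (n - 2)"
    define t where "t = z - real j"
    have t: "0 \<le> t" "t \<le> 1"
    proof -
      have f: "real (nat \<lfloor>z\<rfloor>) \<le> z" "z < real (nat \<lfloor>z\<rfloor>) + 1" using 3 by linarith+
      have n2: "real (n - 2) = real n - 2" using n_ge_2 by (simp add: of_nat_diff)
      show "0 \<le> t" using f unfolding t_def j_def by (simp add: min_def)
      show "t \<le> 1"
      proof (cases "nat \<lfloor>z\<rfloor> \<le> n - 2")
        case True
        then have "j = nat \<lfloor>z\<rfloor>" by (simp add: j_def)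
        then show ?thesis using f unfolding t_def by linarith
      next
        case False
        then have "j = n - 2" by (simp add: j_def)
        then show ?thesis using 3 n2 unfolding t_def by linarith
      qed
    qed
    have jn: "j < n - 1" "j < n" "Suc j < n" using n_ge_2 unfolding j_def by auto
    define p where "p = (1 - t) *\<^sub>R vertex n (Suc j) + t *\<^sub>R vertex n (Suc (Suc j))"
    have "p \<in> limit_curve n" unfolding p_def using limit_curveI[OF jn(1) t] .
    moreover have "fst p - snd p = (1 - t) * limit_level j + t * limit_level (Suc j)"
      unfolding p_def vertex_coordinates(1)[OF jn(2), symmetric] vertex_coordinates(1)[OF jn(3), symmetric]
      by (simp add: algebra_simps)
    then have "fst p - snd p = - c" unfolding c limit_level_def t_def by (simp add: algebra_simps)
    then have "p \<in> diagonal c" unfolding diagonal_def by (cases p) simp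
    ultimately show ?thesis unfolding continued_def by blast
  qed
qed

lemma ex1_continued_limit_curve: "\<exists>!p. p \<in> continued (limit_curve n) \<inter> diagonal c"
proof (rule ex_ex1I[OF continued_limit_curve_meets_diagonal])
  fix p q
  assume p: "p \<in> continued (limit_curve n) \<inter> diagonal c" and q: "q \<in> continued (limit_curve n) \<inter> diagonal c"
  obtain x y x' y' where xy: "p = (x, y)" "q = (x', y')" by (metis surj_pair)
  have "x + y = limit_height (x - y)" "x' + y' = limit_height (x' - y')"
    using p q continued_limit_curveD xy by auto
  moreover have "y = x + c" "y' = x' + c" using p q xy by (auto simp: diagonal_def)
  ultimately show "p = q" unfolding xy by simp
qed

text \<open>The sum of the squares of 2 i + 1 - n is n (n^2 - 1) / 3; this is the origin of the
  square roots of 6 and of n^2 - 1 in \<open>gamma_const\<close>.\<close>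

lemma speed_square_sum: "(\<Sum>i<n. (speed i)\<^sup>2) / (2 * real n) = (1 / (real n * (real n - 1) * scale))\<^sup>2"
proof -
  have n2: "real n \<noteq> 0" "real n - 1 \<noteq> 0" "(real n)\<^sup>2 - 1 > 0"
    using n_ge_2 by (auto simp: one_less_power)
  have "(\<Sum>i<n. (speed i)\<^sup>2) = (\<Sum>i<n. (2 * real i + 1 - real n)\<^sup>2) / (real n * (real n - 1))\<^sup>2"
    by (simp add: speed_def power_divide sum_divide_distrib)
  also have "(\<Sum>i<n. (2 * real i + 1 - real n)\<^sup>2) = real n * ((real n)\<^sup>2 - 1) / 3"
    unfolding sum_odd_squares by (simp add: power2_eq_square field_simps)
  finally have "(\<Sum>i<n. (speed i)\<^sup>2) / (2 * real n) = ((real n)\<^sup>2 - 1) / 6 / (real n * (real n - 1))\<^sup>2"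
    using n2 by (simp add: field_simps)
  moreover have "scale\<^sup>2 = 6 / ((real n)\<^sup>2 - 1)"
    using n2 by (simp add: scale_def power_divide)
  then have "(1 / (real n * (real n - 1) * scale))\<^sup>2 = ((real n)\<^sup>2 - 1) / 6 / (real n * (real n - 1))\<^sup>2"
    by (simp add: power_divide power_mult_distrib)
  ultimately show ?thesis by simp
qed

lemma speed_eq_limit_level: "speed i / sqrt ((\<Sum>i<n. (speed i)\<^sup>2) / (2 * real n)) = limit_level i"
proof -
  have "0 < real n * (real n - 1) * scale" using n_ge_2 scale_pos by simp
  then have "sqrt ((\<Sum>i<n. (speed i)\<^sup>2) / (2 * real n)) = 1 / (real n * (real n - 1) * scale)"
    unfolding speed_square_sum real_sqrt_abs by (intro abs_of_nonneg divide_nonneg_pos) auto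
  then show ?thesis using n_ge_2 by (simp add: speed_def limit_level_def)
qed

section \<open>The boundary curve compared with the levels\<close>

definition mean_distance :: "(nat \<Rightarrow> int) \<Rightarrow> real \<Rightarrow> real" where
  "mean_distance a u = (\<Sum>i<n. \<bar>real_of_int (a i) - u\<bar>) / real n"

lemma mean_distance_lipschitz: "mean_distance a u \<le> mean_distance a w + \<bar>u - w\<bar>"
proof -
  have "(\<Sum>i<n. \<bar>real_of_int (a i) - u\<bar>) \<le> (\<Sum>i<n. \<bar>real_of_int (a i) - w\<bar> + \<bar>u - w\<bar>)"
    by (intro sum_mono) linarith
  then show ?thesis using n_ge_2 by (simp add: mean_distance_def sum.distrib field_simps)
qed

text \<open>Replacing the integer quotient by the real one costs at most 1 per runner.\<close>

lemma height_approx: "\<bar>real_of_int (height a c) - mean_distance a (real_of_int c)\<bar> \<le> real n"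
proof -
  have n0: "0 < real n" using n_ge_2 by simp
  have "abs (real_of_int \<bar>x div int n\<bar> - \<bar>real_of_int x\<bar> / real n) \<le> 1" for x
  proof -
    have "real_of_int (x div int n) = of_int \<lfloor>real_of_int x / real n\<rfloor>"
      using floor_divide_of_int_eq[of x "int n", where 'a = real] by simp
    moreover have "\<bar>real_of_int x\<bar> / real n = \<bar>real_of_int x / real n\<bar>" using n0 by (simp add: abs_divide)
    ultimately show ?thesis by linarith
  qed
  then have "abs (real_of_int \<bar>(a i - c) div int n\<bar> - \<bar>real_of_int (a i) - real_of_int c\<bar> / real n) \<le> 1" for i
    by (metis of_int_diff)
  then have "abs (\<Sum>i<n. real_of_int \<bar>(a i - c) div int n\<bar> - \<bar>real_of_int (a i) - real_of_int c\<bar> / real n) \<le> (\<Sum>i<n. 1)"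
    by (intro order_trans[OF sum_abs sum_mono]) auto
  then show ?thesis
    by (simp only: sum_subtractf mean_distance_def height_def of_int_sum sum_divide_distrib) simp
qed

text \<open>The constant n + 3 collects n for the integer quotients in \<open>height\<close>, 1 for
  passing from the content of a box to X - Y, and 2 for replacing i + j by X + Y. The two bounds
  come from a box of the diagram containing the point and from a nearby position outside the
  diagram.\<close>

lemma continued_boundary_height:
  assumes ad: "admissible (height a) B" and D: "D = diagram_of (height a)" "D \<noteq> {}"
    and s: "s = sqrt (real (card D))"
    and p: "(x, y) \<in> continued (boundary_curve D)"
  shows "\<bar>(x + y) - (\<Sum>i<n. \<bar>real_of_int (a i) / s - (x - y)\<bar>) / real n\<bar> \<le> (real n + 3) / s"
proof -
  have yd: "young_diagram D" unfolding D(1) by (rule young_diagram_of[OF ad])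
  have ge: "\<bar>c\<bar> \<le> height a c" for c using ad by (simp add: admissible_def)
  have "0 < card D" using yd D(2) by (simp add: young_diagram_def card_gt_0_iff)
  then have s0: "0 < s" unfolding s by simp
  define R where "R = (\<lambda>p. p /\<^sub>R s) ` region D"
  have "scaled_region D = R" unfolding scaled_region_def measure_region[OF yd] R_def s ..
  then have bc: "boundary_curve D = R \<inter> closure (quadrant - R)" by (simp add: boundary_curve_def)
  interpret staircase_region R unfolding R_def by (rule scaled_region_staircase[OF yd D(2) s0])
  have RI: "(u, v) \<in> R \<longleftrightarrow> (s * u, s * v) \<in> region D" for u v
  proof
    assume "(u, v) \<in> R"
    then obtain u' v' where "(u', v') \<in> region D" "u = u' /\<^sub>R s" "v = v' /\<^sub>R s" unfolding R_def by auto
    then show "(s * u, s * v) \<in> region D" using s0 by (simp flip: mult.assoc)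
  next
    assume *: "(s * u, s * v) \<in> region D"
    have "(u, v) = (s * u, s * v) /\<^sub>R s" using s0 by simp
    then show "(u, v) \<in> R" unfolding R_def using * by (rule image_eqI)
  qed
  note cb = continued_boundaryD[OF p[unfolded bc]]
  define X where "X = s * x"
  define Y where "Y = s * y"
  have pos: "0 \<le> X" "0 \<le> Y" using cb(1) R_nonneg s0 unfolding X_def Y_def by auto
  have happ: "real_of_int (height a c) \<le> mean_distance a (X - Y) + \<bar>real_of_int c - (X - Y)\<bar> + real n"
    "mean_distance a (X - Y) - \<bar>real_of_int c - (X - Y)\<bar> - real n \<le> real_of_int (height a c)" for c
    using height_approx[of a c] mean_distance_lipschitz[of a "real_of_int c" "X - Y"]
      mean_distance_lipschitz[of a "X - Y" "real_of_int c"] by linarith+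
  have upper: "X + Y \<le> mean_distance a (X - Y) + (real n + 3)"
  proof (cases "(x, y) \<in> R")
    case True
    then have "(X, Y) \<in> region D" unfolding RI X_def Y_def .
    then obtain i j where ij: "(i, j) \<in> D" "real j - 1 \<le> X" "X \<le> real j" "real i - 1 \<le> Y" "Y \<le> real i"
      unfolding mem_region_iff by blast
    have "int i + int j \<le> height a (int j - int i)" using ij(1) unfolding D(1) diagram_of_def by simp
    then have "real i + real j \<le> real_of_int (height a (int j - int i))" by linarith
    then show ?thesis using happ(1)[of "int j - int i"] ij by simp
  next
    case False
    \<comment> \<open>On the continued part of an axis there is no box, and the general bound
      \<open>\<bar>c\<bar> \<le> height a c\<close> replaces it.\<close>
    then have "X + Y = \<bar>X - Y\<bar>" using cb(1) pos unfolding X_def Y_def by auto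
    moreover have "\<bar>real_of_int \<lfloor>X - Y\<rfloor>\<bar> \<le> real_of_int (height a \<lfloor>X - Y\<rfloor>)"
      using ge[of "\<lfloor>X - Y\<rfloor>"] by linarith
    ultimately show ?thesis using happ(1)[of "\<lfloor>X - Y\<rfloor>"] by linarith
  qed
  have lower: "mean_distance a (X - Y) - (real n + 3) \<le> X + Y"
  proof -
    \<comment> \<open>The position whose half-open cell contains (X, Y): a small diagonal push stays
      in that box, so the box cannot belong to \<open>D\<close>.\<close>
    define i where "i = nat \<lfloor>Y\<rfloor> + 1"
    define j where "j = nat \<lfloor>X\<rfloor> + 1"
    have ij: "real i - 1 \<le> Y" "Y < real i" "real j - 1 \<le> X" "X < real j"
      using pos unfolding i_def j_def by linarith+
    have "(i, j) \<notin> D"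
    proof
      assume mem: "(i, j) \<in> D"
      define e where "e = min (real j - X) (real i - Y)"
      have e: "0 < e" "X + e \<le> real j" "Y + e \<le> real i" using ij unfolding e_def by auto
      then have "(X + e, Y + e) \<in> region D"
        unfolding mem_region_iff using mem ij by (intro exI[of _ i] exI[of _ j]) auto
      then have "(x + e / s, y + e / s) \<in> R" unfolding RI X_def Y_def using s0 by (simp add: distrib_left)
      then show False using cb(2) e(1) s0 by auto
    qed
    then have "height a (int j - int i) < int i + int j"
      unfolding D(1) diagram_of_def by (simp add: i_def j_def)
    then have "real_of_int (height a (int j - int i)) \<le> real i + real j" by linarith
    moreover have "\<bar>real_of_int (int j - int i) - (X - Y)\<bar> \<le> 1" using ij by auto
    ultimately show ?thesis using happ(2)[of "int j - int i"] ij by linarith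
  qed
  have "(\<Sum>i<n. \<bar>real_of_int (a i) / s - (x - y)\<bar>) = (\<Sum>i<n. \<bar>real_of_int (a i) - (X - Y)\<bar> / s)"
  proof (intro sum.cong refl)
    fix i
    have "real_of_int (a i) / s - (x - y) = (real_of_int (a i) - (X - Y)) / s"
      unfolding X_def Y_def using s0 by (simp add: field_simps)
    then show "\<bar>real_of_int (a i) / s - (x - y)\<bar> = \<bar>real_of_int (a i) - (X - Y)\<bar> / s"
      using s0 by (simp add: abs_divide)
  qed
  then have "(\<Sum>i<n. \<bar>real_of_int (a i) / s - (x - y)\<bar>) / real n = mean_distance a (X - Y) / s"
    by (simp add: mean_distance_def sum_divide_distrib[symmetric])
  moreover have "x + y = (X + Y) / s" unfolding X_def Y_def using s0 by (simp add: field_simps)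
  ultimately have "(x + y) - (\<Sum>i<n. \<bar>real_of_int (a i) / s - (x - y)\<bar>) / real n =
      ((X + Y) - mean_distance a (X - Y)) / s" by (simp add: diff_divide_distrib)
  moreover have "\<bar>(X + Y) - mean_distance a (X - Y)\<bar> \<le> real n + 3" using upper lower by linarith
  ultimately show ?thesis using s0 by (simp add: abs_divide divide_right_mono)
qed

text \<open>Points on a common diagonal are compared through x + y alone, and replacing the scaled
  levels by their limits changes the mean distance by at most the average displacement.\<close>

lemma curve_dist_le:
  assumes ad: "admissible (height a) B" and D: "D = diagram_of (height a)" "D \<noteq> {}"
    and s: "s = sqrt (real (card D))"
    and le: "(real n + 3) / s + (\<Sum>i<n. \<bar>real_of_int (a i) / s - limit_level i\<bar>) / real n \<le> \<delta>"
  shows "curve_dist (boundary_curve D) (limit_curve n) \<le> \<delta>"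
  unfolding curve_dist_def
proof (rule cSUP_least)
  fix c
  have yd: "young_diagram D" unfolding D(1) by (rule young_diagram_of[OF ad])
  have "0 < card D" using yd D(2) by (simp add: young_diagram_def card_gt_0_iff)
  then have s0: "0 < s" unfolding s by simp
  have "scaled_region D = (\<lambda>p. p /\<^sub>R s) ` region D" unfolding scaled_region_def measure_region[OF yd] s ..
  then interpret staircase_region "scaled_region D"
    using scaled_region_staircase[OF yd D(2) s0] by simp
  define p where "p = (THE p. p \<in> continued (boundary_curve D) \<inter> diagonal c)"
  define q where "q = (THE p. p \<in> continued (limit_curve n) \<inter> diagonal c)"
  have "p \<in> continued (boundary_curve D) \<inter> diagonal c"
    unfolding p_def boundary_curve_def by (rule theI'[OF ex1_continued_boundary])
  moreover have "q \<in> continued (limit_curve n) \<inter> diagonal c"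
    unfolding q_def by (rule theI'[OF ex1_continued_limit_curve])
  ultimately obtain x x' where xp: "p = (x, x + c)" "q = (x', x' + c)"
    and mem: "(x, x + c) \<in> continued (boundary_curve D)" "(x', x' + c) \<in> continued (limit_curve n)"
    by (auto simp: diagonal_def)
  define S where "S = (\<Sum>i<n. \<bar>real_of_int (a i) / s - (- c)\<bar>)"
  define T where "T = (\<Sum>i<n. \<bar>limit_level i - (- c)\<bar>)"
  have b: "\<bar>(x + (x + c)) - S / real n\<bar> \<le> (real n + 3) / s"
    using continued_boundary_height[OF ad D s mem(1)] by (simp add: S_def)
  have l: "x' + (x' + c) = T / real n"
    using continued_limit_curveD[OF mem(2)] by (simp add: T_def limit_height_def)
  have "\<bar>S - T\<bar> \<le> (\<Sum>i<n. \<bar>real_of_int (a i) / s - limit_level i\<bar>)"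
    unfolding S_def T_def sum_subtractf[symmetric]
    by (intro order_trans[OF sum_abs sum_mono]) linarith
  then have st: "\<bar>S / real n - T / real n\<bar> \<le> (\<Sum>i<n. \<bar>real_of_int (a i) / s - limit_level i\<bar>) / real n"
    using n_ge_2 by (simp add: diff_divide_distrib[symmetric] abs_divide divide_right_mono)
  have "dist p q = sqrt ((x - x')\<^sup>2 + (x - x')\<^sup>2)"
    by (simp add: xp dist_Pair_Pair dist_real_def)
  \<comment> \<open>The distance is the square root of 2 times the difference in x; the cruder
    factor 2 gives exactly the difference of the two values of x + y.\<close>
  also have "\<dots> \<le> \<bar>x - x'\<bar> + \<bar>x - x'\<bar>" by (rule sqrt_sum_squares_le_sum_abs)
  also have "\<dots> \<le> \<delta>" using b l st le by linarith
  finally show "dist (THE p. p \<in> continued (boundary_curve D) \<inter> diagonal c)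
      (THE p. p \<in> continued (limit_curve n) \<inter> diagonal c) \<le> \<delta>"
    unfolding p_def q_def .
qed simp

end

theorem theorem3p2:
  fixes n :: nat
  assumes "n \<ge> 2"
  shows "\<forall>\<epsilon>>0. \<forall>\<delta>>0. \<exists>L::nat. \<forall>K>L.
    measure_pmf.prob (random_core n K)
      {D. D = {} \<or> curve_dist (boundary_curve D) (limit_curve n) > \<delta>} < \<epsilon>"
proof (intro allI impI)
  fix \<epsilon> \<delta> :: real
  assume \<epsilon>: "0 < \<epsilon>" and \<delta>: "0 < \<delta>"
  interpret core_growth n by unfold_locales (rule assms)
  define \<alpha> where "\<alpha> = (\<Sum>i<n. (speed i)\<^sup>2) / (2 * real n)"
  have pos: "0 < real n * (real n - 1) * scale" using n_ge_2 scale_pos by simp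
  have \<alpha>: "0 < \<alpha>" unfolding \<alpha>_def speed_square_sum
    by (rule zero_less_power[OF divide_pos_pos[OF zero_less_one pos]])
  define q where "q = (\<Sum>i<n. (real i)\<^sup>2)"
  have n0: "0 < n" using n_ge_2 by simp
  obtain \<eta> L where \<eta>: "0 < \<eta>" and L: "\<And>K x s. L \<le> K \<Longrightarrow>
      (\<forall>i<n. \<bar>x i - real K * speed i\<bar> \<le> \<eta> * real K) \<Longrightarrow>
      s = sqrt (((\<Sum>i<n. (x i)\<^sup>2) - q) / (2 * real n)) \<Longrightarrow>
      0 < s \<and> (real n + 3) / s + (\<Sum>i<n. \<bar>x i / s - speed i / sqrt \<alpha>\<bar>) / real n \<le> \<delta>"
    using scaled_levels_limit[OF n0 \<alpha>_def \<alpha> \<delta>, of q "real n + 3"] by blast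
  define bad where "bad K = {ts. \<exists>i<n. \<eta> * real K < \<bar>real_of_int (core_levels ts i) - real K * speed i\<bar>}" for K
  have "\<forall>\<^sub>F K in sequentially. measure_pmf.prob (choices K) (bad K) < \<epsilon>"
    using levels_concentration[OF \<eta>] \<epsilon> unfolding bad_def by (rule order_tendstoD)
  then obtain L' where L': "\<And>K. L' \<le> K \<Longrightarrow> measure_pmf.prob (choices K) (bad K) < \<epsilon>"
    unfolding eventually_sequentially by blast
  show "\<exists>L. \<forall>K>L. measure_pmf.prob (random_core n K)
      {D. D = {} \<or> curve_dist (boundary_curve D) (limit_curve n) > \<delta>} < \<epsilon>"
  proof (intro exI[of _ "max L L'"] allI impI)
    fix K assume K: "max L L' < K"
    let ?E = "{D. D = {} \<or> curve_dist (boundary_curve D) (limit_curve n) > \<delta>}"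
    have "measure_pmf.prob (random_core n K) ?E =
        measure_pmf.prob (choices K) ((\<lambda>ts. fold (growth_step n) ts {}) -` ?E)"
      unfolding random_core_eq_map_choices by (rule measure_map_pmf)
    also have "\<dots> \<le> measure_pmf.prob (choices K) (bad K)"
    proof (rule measure_pmf.finite_measure_mono_AE)
      show "AE ts in measure_pmf (choices K).
          ts \<in> (\<lambda>ts. fold (growth_step n) ts {}) -` ?E \<longrightarrow> ts \<in> bad K"
        unfolding AE_measure_pmf_iff
      proof (intro ballI impI, rule ccontr)
        fix ts assume ts: "ts \<in> set_pmf (choices K)" and good: "ts \<notin> bad K"
          and E: "ts \<in> (\<lambda>ts. fold (growth_step n) ts {}) -` ?E"
        have set: "set ts \<subseteq> {0..<n}" using ts by (simp add: set_choices)
        define a where "a = core_levels ts"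
        define D where "D = diagram_of (height a)"
        define s where "s = sqrt (real (card D))"
        note inv = core_levels_invariants[OF set, folded a_def, folded D_def]
        have "real_of_int (\<Sum>i<n. (a i)\<^sup>2) = real_of_int ((\<Sum>i<n. (int i)\<^sup>2) + 2 * int n * int (card D))"
          using inv(4) by (rule arg_cong)
        then have "(\<Sum>i<n. (real_of_int (a i))\<^sup>2) - q = 2 * real n * real (card D)"
          by (simp add: q_def)
        then have s: "s = sqrt (((\<Sum>i<n. (real_of_int (a i))\<^sup>2) - q) / (2 * real n))"
          using n0 by (simp add: s_def)
        have near: "\<forall>i<n. \<bar>real_of_int (a i) - real K * speed i\<bar> \<le> \<eta> * real K"
          using good unfolding bad_def a_def mem_Collect_eq by (meson not_le)
        have "L \<le> K" using K by simp
        from L[OF this near s] have s0: "0 < s"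
          and le: "(real n + 3) / s + (\<Sum>i<n. \<bar>real_of_int (a i) / s - limit_level i\<bar>) / real n \<le> \<delta>"
          unfolding \<alpha>_def speed_eq_limit_level by auto
        \<comment> \<open>An empty diagram would make \<open>s\<close> zero, so the positivity of
          \<open>s\<close> also excludes the undefined case counted in the event.\<close>
        have ne: "D \<noteq> {}" using s0 by (auto simp: s_def)
        have "curve_dist (boundary_curve D) (limit_curve n) \<le> \<delta>"
          by (rule curve_dist_le[OF inv(2) D_def ne s_def le])
        then show False using E ne inv(3) by auto
      qed
    qed simp
    also have "\<dots> < \<epsilon>" using L'[of K] K by simp
    finally show "measure_pmf.prob (random_core n K) ?E < \<epsilon>" .
  qed
qed

end
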